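(* Let $n,m$ be positive integers, let $W$ be any symmetric $BGW(n+1,n,n-1)$ with zero diagonal entries over the cyclic group $C_m=\langle U\rangle$ of order $m$, and let $A_{l,0},A_{l,1}$ ($l=0,\dots,m-1$) be the matrices constructed from $W$ in the context. (1) If $m$ is even, then the set of matrices $\{A_{0,0},\ A_{i,0}+A_{m-i,0},\ A_{m/2,0},\ A_{0,1},\ A_{i,1}+A_{m-i,1},\ A_{m/2,1}\mid i=1,\dots,m/2-1\}$ is a symmetric association scheme with the second eigenmatrix $$Q=\begin{pmatrix}\chi_0 & n\chi_0 & \frac{n+1}2\chi_{m/2} & \frac{n+1}2\chi_{m/2} & \cdots & \frac{n+1}2(\chi_k+\chi_{m-k}) & \cdots\\ \chi_0 & -\chi_0 & \frac{n+1}{2\sqrt n}\chi_{m/2} & -\frac{n+1}{2\sqrt n}\chi_{m/2} & \cdots & \frac{n+1}{2}(\chi_k+\chi_{m-k}) & \cdots\end{pmatrix},$$ where $k$ runs over $\{1,\dots,m/2-1\}$. (2) If $m$ is odd, then the set of matrices $\{A_{0,0},\ A_{i,0}+A_{m-i,0},\ A_{0,1},\ A_{i,1}+A_{m-i,1}\mid i=1,\dots,(m-1)/2\}$ is a symmetric association scheme with the second eigenmatrix $$Q=\begin{pmatrix}\chi_0 & n\chi_0 & \cdots & \frac{n+1}2(\chi_k+\chi_{m-k}) & \cdots\\ \chi_0 & -\chi_0 & \cdots & \frac{n+1}{2}(\chi_k+\chi_{m-k}) & \cdots\end{pmatrix},$$ where $k$ runs over $\{1,\dots,(m-1)/2\}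$.
   Context: $I_r$, $J_r$: identity and all-ones matrices of order $r$. A set of nonzero $v\times v$ $(0,1)$-matrices $\{A_0,\dots,A_d\}$ is an association scheme if $A_0=I_v$ (for one labelled $A_0$), $\sum_iA_i=J_v$, $A_i^\top\in\{A_1,\dots,A_d\}$ for $i\ge1$, and every product $A_iA_j$ is a linear combination of $A_0,\dots,A_d$; it is symmetric if all $A_i$ are symmetric (it is then commutative). For a symmetric scheme with adjacency matrices $B_0,\dots,B_e$ and primitive idempotents $E_0,\dots,E_e$ of its adjacency algebra (the complex span of the $B_l$), the second eigenmatrix $Q=(q_{l,k})$ is defined by $E_k=\frac1v\sum_lq_{l,k}B_l$. For a finite multiplicative group $G$, a balanced generalized weighing matrix $BGW(v,k,\lambda)$ over $G$ is a $v\times v$ matrix $W=(w_{ij})$ with entries in $G\cup\{0\}$ such that (i) every row contains exactly $k$ nonzero entries, and (ii) for any distinct $i,h$, every element of $G$ occurs exactly $\lambda/|G|$ times in the multiset $\{w_{ij}w_{hj}^{-1}\mid 1\le j\le v,\ w_{ij}\ne0,\ w_{hj}\neq0\}$. It is symmetric if $w_{ij}=w_{ji}$ for all $i,j$. $U$ is the circulant matrix of order $m$ with first row $(0,1,0,\dots,0)$, and $C_m=\langle U\rangle$, so each nonzero $w_{ij}$ is a power of $U$. $R$ is the back diagonal matrix of order $m$ (ones on the anti-diagonal, zeros elsewhere). For $l\in\{0,\dots,m-1\}$, $N_l$ is the $(n+1)m\times(n+1)m$ $(0,1)$-matrix with $m\times m$ blocks $[N_l]_{ij}=J_m$ if $i=j$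 and $[N_l]_{ij}=w_{ij}U^lR$ if $i\ne j$. Define $A_{l,0}=I_{n+1}\otimes U^l$ and $A_{l,1}=N_l-I_{n+1}\otimes J_m$. $\chi_\beta$ ($\beta\in\mathbb{Z}_m$) is the irreducible character of $\mathbb{Z}_m$ given by $\chi_\beta(\alpha)=w^{\alpha\beta}$, $w=e^{2\pi\sqrt{-1}/m}$, written as a column vector. The upper block of $Q$ refers to the matrices formed from the $A_{l,0}$ and the lower block to those formed from the $A_{l,1}$.
   Formalization: The displayed Q is corrected: each k contributes two columns, with upper block (n+1)/2 (chi_k+chi_{m-k}) and lower blocks ±(n+1)/(2 sqrt n) (chi_k+chi_{m-k}), instead of the printed (n+1)/2 (chi_k+chi_{m-k}), which gives no idempotent for n>1 and a non-square Q if read as one column per k. *)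

theory Defs
  imports Complex_Main "HOL-Algebra.Group" "Jordan_Normal_Form.Matrix"
begin

section \<open>Association schemes and second eigenmatrices\<close>

definition all_ones :: "nat \<Rightarrow> complex mat" where
  "all_ones r = mat r r (\<lambda>_. 1)"

definition lin_comb :: "nat \<Rightarrow> (nat \<Rightarrow> complex) \<Rightarrow> complex mat list \<Rightarrow> complex mat" where
  "lin_comb v c Bs = mat v v (\<lambda>(a, b). \<Sum>l<length Bs. c l * (Bs ! l) $$ (a, b))"

definition adjacency_algebra :: "nat \<Rightarrow> complex mat list \<Rightarrow> complex mat set" where
  "adjacency_algebra v Bs = range (\<lambda>c. lin_comb v c Bs)"

text \<open>The adjacency matrices are listed as $A_0, \dots, A_d$; the identity is the head of the
  list.  As the matrices are nonzero $(0,1)$-matrices summing to the all-ones matrix, no two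
  entries of the list coincide.\<close>

definition association_scheme :: "nat \<Rightarrow> complex mat list \<Rightarrow> bool" where
  "association_scheme v As \<longleftrightarrow>
     As \<noteq> [] \<and>
     (\<forall>A\<in>set As. A \<in> carrier_mat v v \<and> A \<noteq> 0\<^sub>m v v \<and>
        (\<forall>a<v. \<forall>b<v. A $$ (a, b) \<in> {0, 1})) \<and>
     hd As = 1\<^sub>m v \<and>
     lin_comb v (\<lambda>_. 1) As = all_ones v \<and>
     (\<forall>A\<in>set (tl As). transpose_mat A \<in> set (tl As)) \<and>
     (\<forall>A\<in>set As. \<forall>B\<in>set As. A * B \<in> adjacency_algebra v As)"

definition symmetric_association_scheme :: "nat \<Rightarrow> complex mat list \<Rightarrow> bool" where
  "symmetric_association_scheme v As \<longleftrightarrow>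
     association_scheme v As \<and> (\<forall>A\<in>set As. transpose_mat A = A)"

definition primitive_idempotents :: "nat \<Rightarrow> complex mat list \<Rightarrow> complex mat set" where
  "primitive_idempotents v Bs =
     {E \<in> adjacency_algebra v Bs. E \<noteq> 0\<^sub>m v v \<and> E * E = E \<and>
        \<not> (\<exists>F\<in>adjacency_algebra v Bs. \<exists>G\<in>adjacency_algebra v Bs.
              F \<noteq> 0\<^sub>m v v \<and> G \<noteq> 0\<^sub>m v v \<and> F * F = F \<and> G * G = G \<and>
              F * G = 0\<^sub>m v v \<and> G * F = 0\<^sub>m v v \<and> E = F + G)}"

text \<open>The rows of $Q$ follow the order of the list \<open>Bs\<close>; the order of the columns is that of the
  enumeration \<open>Es\<close> of the primitive idempotents, so $Q$ is determined up to a permutation of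
  its columns.\<close>

definition second_eigenmatrix :: "nat \<Rightarrow> complex mat list \<Rightarrow> complex mat \<Rightarrow> bool" where
  "second_eigenmatrix v Bs Q \<longleftrightarrow>
     Q \<in> carrier_mat (length Bs) (length Bs) \<and>
     (\<exists>Es. length Es = length Bs \<and> distinct Es \<and> set Es = primitive_idempotents v Bs \<and>
        (\<forall>k<length Bs.
           Es ! k = (1 / of_nat v) \<cdot>\<^sub>m lin_comb v (\<lambda>l. Q $$ (l, k)) Bs))"


section \<open>Balanced generalized weighing matrices\<close>

text \<open>An entry \<open>None\<close> stands for $0$, an entry \<open>Some g\<close> for the group element $g$.  The group
  axioms for \<open>G\<close> are not part of the definition; for the cyclic group used below they are
  proved as \<open>group_cyclic_group_mat\<close>.\<close>

definition BGW ::
  "('a, 'b) monoid_scheme \<Rightarrow> nat \<Rightarrow> nat \<Rightarrow> nat \<Rightarrow> 'a option mat \<Rightarrow> bool" where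
  "BGW G v k lam W \<longleftrightarrow>
     W \<in> carrier_mat v v \<and>
     (\<forall>i<v. \<forall>j<v. W $$ (i, j) \<in> insert None (Some ` carrier G)) \<and>
     (\<forall>i<v. card {j. j < v \<and> W $$ (i, j) \<noteq> None} = k) \<and>
     (\<forall>i<v. \<forall>h<v. i \<noteq> h \<longrightarrow> (\<forall>g\<in>carrier G.
        real (card {j. j < v \<and> (\<exists>a b. W $$ (i, j) = Some a \<and> W $$ (h, j) = Some b \<and>
                                        a \<otimes>\<^bsub>G\<^esub> inv\<^bsub>G\<^esub> b = g)})
        = real lam / real (card (carrier G))))"


section \<open>The matrices constructed from a BGW matrix over a cyclic group\<close>

text \<open>For $m = 1$ the circulant matrix is read as $(1)$.\<close>

definition U_mat :: "nat \<Rightarrow> complex mat" where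
  "U_mat m = mat m m (\<lambda>(i, j). if j = (i + 1) mod m then 1 else 0)"

definition R_mat :: "nat \<Rightarrow> complex mat" where
  "R_mat m = mat m m (\<lambda>(i, j). if i + j + 1 = m then 1 else 0)"

definition cyclic_group_mat :: "nat \<Rightarrow> complex mat monoid" where
  "cyclic_group_mat m =
     \<lparr>carrier = range (\<lambda>l::nat. U_mat m ^\<^sub>m l), mult = (*), one = 1\<^sub>m m\<rparr>"

lemma U_mat_pow: "U_mat m ^\<^sub>m l = mat m m (\<lambda>(i, j). if j = (i + l) mod m then 1 else 0)"
proof (induction l)
  case 0
  show ?case by (auto simp: U_mat_def)
next
  case (Suc l)
  have "(\<Sum>k = 0..<m. (if k = (i + l) mod m then 1 else 0) * (if j = Suc k mod m then 1 else 0))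
        = (if j = Suc (i + l) mod m then 1 else (0 :: complex))" if "i < m" for i j
  proof -
    have "(\<Sum>k = 0..<m. (if k = (i + l) mod m then 1 else 0) * (if j = Suc k mod m then 1 else 0))
        = (\<Sum>k = 0..<m. if k = (i + l) mod m
             then (if j = Suc ((i + l) mod m) mod m then 1 else (0 :: complex)) else 0)"
      by (intro sum.cong) auto
    then show ?thesis using that by (simp add: mod_Suc_eq)
  qed
  then show ?case
    unfolding pow_mat.simps Suc by (intro eq_matI) (auto simp: U_mat_def scalar_prod_def)
qed

lemma group_cyclic_group_mat:
  assumes "m > 0"
  shows "group (cyclic_group_mat m)" and "card (carrier (cyclic_group_mat m)) = m"
proof -
  have U: "U_mat m \<in> carrier_mat m m" by (simp add: U_mat_def)
  have add: "U_mat m ^\<^sub>m (a + b) = U_mat m ^\<^sub>m a * U_mat m ^\<^sub>m b" for a b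
    using U by (induction b) (auto simp: assoc_mult_mat[of _ m m _ m _ m] pow_carrier_mat)
  have md: "U_mat m ^\<^sub>m a = U_mat m ^\<^sub>m (a mod m)" for a
    by (simp add: U_mat_pow mod_add_right_eq)
  have one: "U_mat m ^\<^sub>m 0 = 1\<^sub>m m" using U by simp
  show "group (cyclic_group_mat m)"
  proof (rule groupI)
    fix x assume "x \<in> carrier (cyclic_group_mat m)"
    then obtain a where a: "x = U_mat m ^\<^sub>m a" by (auto simp: cyclic_group_mat_def)
    have "U_mat m ^\<^sub>m (m * a - a) * x = 1\<^sub>m m"
      using assms md[of "m * a"] one by (simp add: a flip: add)
    then show "\<exists>y\<in>carrier (cyclic_group_mat m).
        y \<otimes>\<^bsub>cyclic_group_mat m\<^esub> x = \<one>\<^bsub>cyclic_group_mat m\<^esub>"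
      by (auto simp: cyclic_group_mat_def)
  next
    show "\<one>\<^bsub>cyclic_group_mat m\<^esub> \<in> carrier (cyclic_group_mat m)"
      using one by (auto simp: cyclic_group_mat_def intro: range_eqI[of _ _ 0])
  qed (use U in \<open>auto simp: cyclic_group_mat_def pow_carrier_mat add.assoc
         simp flip: add\<close>)
  have "carrier (cyclic_group_mat m) = (\<lambda>l. U_mat m ^\<^sub>m l) ` {..<m}"
    using md assms by (force simp: cyclic_group_mat_def)
  moreover have "inj_on (\<lambda>l. U_mat m ^\<^sub>m l) {..<m}"
  proof (rule inj_onI)
    fix a b assume ab: "a \<in> {..<m}" "b \<in> {..<m}" "U_mat m ^\<^sub>m a = U_mat m ^\<^sub>m b"
    then have "(U_mat m ^\<^sub>m a) $$ (0, a) = (U_mat m ^\<^sub>m b) $$ (0, a)" by simp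
    moreover have "(U_mat m ^\<^sub>m c) $$ (0, a) = (if a = c mod m then 1 else 0)" for c
      using ab(1) by (simp add: U_mat_pow)
    ultimately show "a = b" using ab(1,2) by (simp split: if_splits)
  qed
  ultimately show "card (carrier (cyclic_group_mat m)) = m" by (simp add: card_image)
qed

definition kron :: "complex mat \<Rightarrow> complex mat \<Rightarrow> complex mat" where
  "kron A B = mat (dim_row A * dim_row B) (dim_col A * dim_col B)
     (\<lambda>(i, j). A $$ (i div dim_row B, j div dim_col B) * B $$ (i mod dim_row B, j mod dim_col B))"

text \<open>The $rm \times rm$ matrix whose $(i,j)$ block is the $m \times m$ matrix \<open>F i j\<close>.\<close>

definition block_mat :: "nat \<Rightarrow> nat \<Rightarrow> (nat \<Rightarrow> nat \<Rightarrow> complex mat) \<Rightarrow> complex mat" where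
  "block_mat r m F = mat (r * m) (r * m) (\<lambda>(i, j). F (i div m) (j div m) $$ (i mod m, j mod m))"

definition entry_mat :: "nat \<Rightarrow> complex mat option \<Rightarrow> complex mat" where
  "entry_mat m w = (case w of None \<Rightarrow> 0\<^sub>m m m | Some g \<Rightarrow> g)"

definition N_mat :: "nat \<Rightarrow> nat \<Rightarrow> complex mat option mat \<Rightarrow> nat \<Rightarrow> complex mat" where
  "N_mat n m W l = block_mat (n + 1) m
     (\<lambda>i j. if i = j then all_ones m
            else entry_mat m (W $$ (i, j)) * (U_mat m ^\<^sub>m l) * R_mat m)"

definition A0 :: "nat \<Rightarrow> nat \<Rightarrow> nat \<Rightarrow> complex mat" where
  "A0 n m l = kron (1\<^sub>m (n + 1)) (U_mat m ^\<^sub>m l)"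

definition A1 :: "nat \<Rightarrow> nat \<Rightarrow> complex mat option mat \<Rightarrow> nat \<Rightarrow> complex mat" where
  "A1 n m W l = N_mat n m W l - kron (1\<^sub>m (n + 1)) (all_ones m)"

definition scheme_even :: "nat \<Rightarrow> nat \<Rightarrow> complex mat option mat \<Rightarrow> complex mat list" where
  "scheme_even n m W =
     [A0 n m 0] @ map (\<lambda>i. A0 n m i + A0 n m (m - i)) [1..<m div 2] @ [A0 n m (m div 2)] @
     [A1 n m W 0] @ map (\<lambda>i. A1 n m W i + A1 n m W (m - i)) [1..<m div 2] @ [A1 n m W (m div 2)]"

definition scheme_odd :: "nat \<Rightarrow> nat \<Rightarrow> complex mat option mat \<Rightarrow> complex mat list" where
  "scheme_odd n m W =
     [A0 n m 0] @ map (\<lambda>i. A0 n m i + A0 n m (m - i)) [1..<(m - 1) div 2 + 1] @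
     [A1 n m W 0] @ map (\<lambda>i. A1 n m W i + A1 n m W (m - i)) [1..<(m - 1) div 2 + 1]"


section \<open>The second eigenmatrices\<close>

text \<open>The character $\chi_\beta$ as a column vector.  In the symmetric schemes the matrices in each
  block are indexed by the classes $\{\alpha, -\alpha\}$ of $\mathbb{Z}_m$, so only the entries at
  the representatives $\alpha = 0, \dots, \lfloor m/2 \rfloor$ occur.\<close>

definition chi :: "nat \<Rightarrow> nat \<Rightarrow> complex vec" where
  "chi m \<beta> = vec (m div 2 + 1) (\<lambda>\<alpha>. exp (2 * of_real pi * \<i> / of_nat m) ^ (\<alpha> * \<beta>))"

text \<open>Every pair $\chi_k, \chi_{m-k}$ contributes two columns, as $\chi_{m/2}$ does.  The factor
  $\pm\frac{n+1}{2\sqrt n}$ in the lower block comes from $A_{0,1}^2 (I_{n+1} \otimes F) =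
  n\, I_{n+1} \otimes F$ for the idempotent $F$ of $\mathbb{Z}_m$ that belongs to a nontrivial
  real character or pair of conjugate characters: $I_{n+1} \otimes F$ splits into
  $\frac12 (I_{(n+1)m} \pm \frac1{\sqrt n} A_{0,1})(I_{n+1} \otimes F)$.\<close>

definition Q_pair :: "nat \<Rightarrow> complex vec \<Rightarrow> complex vec list" where
  "Q_pair n x =
     [(of_nat (n + 1) / 2) \<cdot>\<^sub>v x @\<^sub>v (of_nat (n + 1) / (2 * of_real (sqrt (real n)))) \<cdot>\<^sub>v x,
      (of_nat (n + 1) / 2) \<cdot>\<^sub>v x @\<^sub>v (- (of_nat (n + 1) / (2 * of_real (sqrt (real n))))) \<cdot>\<^sub>v x]"

definition Q_even :: "nat \<Rightarrow> nat \<Rightarrow> complex mat" where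
  "Q_even n m = mat_of_cols (2 * (m div 2 + 1))
     ([chi m 0 @\<^sub>v chi m 0, of_nat n \<cdot>\<^sub>v chi m 0 @\<^sub>v - chi m 0] @
      Q_pair n (chi m (m div 2)) @
      concat (map (\<lambda>k. Q_pair n (chi m k + chi m (m - k))) [1..<m div 2]))"

definition Q_odd :: "nat \<Rightarrow> nat \<Rightarrow> complex mat" where
  "Q_odd n m = mat_of_cols (2 * (m div 2 + 1))
     ([chi m 0 @\<^sub>v chi m 0, of_nat n \<cdot>\<^sub>v chi m 0 @\<^sub>v - chi m 0] @
      concat (map (\<lambda>k. Q_pair n (chi m k + chi m (m - k))) [1..<(m - 1) div 2 + 1]))"

end

theory Submission
  imports Defs "HOL-Number_Theory.Cong"
begin

text \<open>
  Give the vertices coordinates $(i, x)$ with $i$ the block and $x \in \mathbb{Z}_m$ the position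
  in it, and write $w_{ij} = U^{e(i,j)}$.  Then $A_{l,0}$ joins $(i,x)$ to $(i,y)$ when
  $y - x = l$, and $A_{l,1}$ joins $(i,x)$ to $(j,y)$, $i \neq j$, when
  $x + y + e(i,j) + 1 = -l$.  After the classes of $l$ and $-l$ are merged, the span therefore
  consists exactly of the matrices $M(f, g)$ (\<open>algebra_mat f g\<close>) whose entry is $f(y - x)$
  inside a block and $g(x + y + e(i,j) + 1)$ outside, for even functions $f, g$ on
  $\mathbb{Z}_m$.  All of them are symmetric.

  Multiplying such matrices means convolving functions on $\mathbb{Z}_m$, so the characters
  diagonalise the product.  Let $\theta_k$ be the real character $\chi_k$ if $2k = 0$ and
  $\chi_k + \chi_{-k}$ otherwise.  If $n d^2 = 1 + (n-1) d\,[k = 0]$, then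
  \[ M(f, g)\, M(\theta_k, d\,\theta_k) = (\hat f(k) + n d\, \hat g(k))\, M(\theta_k, d\,\theta_k) \]
  (lemma \<open>algebra_mat_mult_theta\<close>).  Balancedness of $W$ enters here: the paths through
  a third block average $\theta_k$ over $\mathbb{Z}_m$, which contributes only for $k = 0$.  The
  quadratic equation has the roots $1, -1/n$ for $k = 0$ and $\pm 1/\sqrt n$ for $k \neq 0$, and
  two distinct roots satisfy $1 + n d d' = 0$.  Together with the orthogonality of the characters
  this makes the eigenmatrices of different labels $(k, d)$ orthogonal.  Scaled by $\frac{1}{m (1 + n d^2)}$ they add up to the identity
  (lemma \<open>idempotent_basis_idem\<close>).

  An orthogonal decomposition of the identity into common eigenmatrices, all lying in the algebra,
  determines everything else: the algebra is closed under multiplication, and these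
  eigenmatrices are its primitive idempotents (locale \<open>idempotent_basis\<close>).  Their
  coefficient vectors are the columns of $Q$, the label $(k, d)$ giving
  $\frac{n+1}{1 + n d^2}$ times $\theta_k$ above $d\,\theta_k$.
\<close>

section \<open>Primitive idempotents from an orthogonal decomposition of the identity\<close>

lemma lin_comb_carrier [simp]: "lin_comb v c Bs \<in> carrier_mat v v"
  by (simp add: lin_comb_def)

lemma adjacency_algebra_carrier: "X \<in> adjacency_algebra v Bs \<Longrightarrow> X \<in> carrier_mat v v"
  by (auto simp: adjacency_algebra_def)

lemma adjacency_algebra_minus:
  assumes "X \<in> adjacency_algebra v Bs" "Y \<in> adjacency_algebra v Bs"
  shows "X - Y \<in> adjacency_algebra v Bs"
proof -
  obtain c d where "X = lin_comb v c Bs" "Y = lin_comb v d Bs"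
    using assms by (auto simp: adjacency_algebra_def)
  then have "X - Y = lin_comb v (\<lambda>l. c l - d l) Bs"
    by (intro eq_matI) (auto simp: lin_comb_def left_diff_distrib sum_subtractf)
  then show ?thesis by (auto simp: adjacency_algebra_def)
qed

lemma adjacency_algebra_sum:
  assumes "\<And>i. i \<in> S \<Longrightarrow> E i \<in> adjacency_algebra v Bs"
  shows "mat v v (\<lambda>(a, b). \<Sum>i\<in>S. x i * E i $$ (a, b)) \<in> adjacency_algebra v Bs"
proof -
  have "\<forall>i\<in>S. \<exists>c. E i = lin_comb v c Bs"
    using assms by (auto simp: adjacency_algebra_def)
  then obtain q where q: "\<And>i. i \<in> S \<Longrightarrow> E i = lin_comb v (q i) Bs"
    by metis
  have "mat v v (\<lambda>(a, b). \<Sum>i\<in>S. x i * E i $$ (a, b))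
      = lin_comb v (\<lambda>l. \<Sum>i\<in>S. x i * q i l) Bs" (is "?L = ?R")
  proof (intro eq_matI)
    fix a b assume "a < dim_row ?R" "b < dim_col ?R"
    then have ab: "a < v" "b < v" by (auto simp: lin_comb_def)
    have "?L $$ (a, b) = (\<Sum>i\<in>S. \<Sum>l<length Bs. x i * q i l * Bs ! l $$ (a, b))"
      using ab by (simp add: q lin_comb_def sum_distrib_left mult.assoc)
    also have "\<dots> = (\<Sum>l<length Bs. \<Sum>i\<in>S. x i * q i l * Bs ! l $$ (a, b))"
      by (rule sum.swap)
    also have "\<dots> = ?R $$ (a, b)"
      using ab by (simp add: lin_comb_def sum_distrib_right)
    finally show "?L $$ (a, b) = ?R $$ (a, b)" .
  qed (auto simp: lin_comb_def)
  then show ?thesis by (auto simp: adjacency_algebra_def)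
qed

text \<open>The assumption \<open>eigen\<close> says that every element of the algebra acts on each \<open>E i\<close> by
  a scalar.  Closure of the span of \<open>Bs\<close> under multiplication follows, and it is this
  closure that an association scheme requires.\<close>

locale idempotent_basis =
  fixes v :: nat and Bs :: "complex mat list" and S :: "'i set" and E :: "'i \<Rightarrow> complex mat"
  assumes in_algebra: "i \<in> S \<Longrightarrow> E i \<in> adjacency_algebra v Bs"
    and nonzero: "i \<in> S \<Longrightarrow> E i \<noteq> 0\<^sub>m v v"
    and orthogonal: "i \<in> S \<Longrightarrow> j \<in> S \<Longrightarrow> i \<noteq> j \<Longrightarrow> E i * E j = 0\<^sub>m v v"
    and sum_one: "a < v \<Longrightarrow> b < v \<Longrightarrow> (\<Sum>i\<in>S. E i $$ (a, b)) = 1\<^sub>m v $$ (a, b)"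
    and eigen: "X \<in> adjacency_algebra v Bs \<Longrightarrow> i \<in> S \<Longrightarrow> \<exists>c. X * E i = c \<cdot>\<^sub>m E i"
    and symmetric: "X \<in> adjacency_algebra v Bs \<Longrightarrow> transpose_mat X = X"
begin

lemma carr: "i \<in> S \<Longrightarrow> E i \<in> carrier_mat v v"
  using in_algebra adjacency_algebra_carrier by blast

text \<open>Multiplication by the decomposition of the identity; all later facts reduce a matrix to its
  components \<open>X * E i\<close> in this way.\<close>

lemma expand:
  assumes X: "X \<in> carrier_mat v v" and ab: "a < v" "b < v"
  shows "X $$ (a, b) = (\<Sum>i\<in>S. (X * E i) $$ (a, b))"
proof -
  have "X $$ (a, b) = (X * 1\<^sub>m v) $$ (a, b)" using X by simp
  also have "\<dots> = (\<Sum>c<v. X $$ (a, c) * (\<Sum>i\<in>S. E i $$ (c, b)))"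
    using X ab by (simp add: times_mat_def scalar_prod_def sum_one lessThan_atLeast0
        del: right_mult_one_mat)
  also have "\<dots> = (\<Sum>c<v. \<Sum>i\<in>S. X $$ (a, c) * E i $$ (c, b))"
    by (simp add: sum_distrib_left)
  also have "\<dots> = (\<Sum>i\<in>S. \<Sum>c<v. X $$ (a, c) * E i $$ (c, b))"
    by (rule sum.swap)
  also have "\<dots> = (\<Sum>i\<in>S. (X * E i) $$ (a, b))"
  proof (rule sum.cong[OF refl])
    fix i assume "i \<in> S"
    from carr[OF this] show "(\<Sum>c<v. X $$ (a, c) * E i $$ (c, b)) = (X * E i) $$ (a, b)"
      using X ab by (simp add: scalar_prod_def lessThan_atLeast0)
  qed
  finally show ?thesis .
qed

lemma nonzero_component:
  assumes X: "X \<in> carrier_mat v v" "X \<noteq> 0\<^sub>m v v"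
  shows "\<exists>i\<in>S. X * E i \<noteq> 0\<^sub>m v v"
proof (rule ccontr)
  assume "\<not> ?thesis"
  then have "X = 0\<^sub>m v v"
    using X(1) expand[OF X(1)] by (intro eq_matI) auto
  with X(2) show False ..
qed

lemma idempotent:
  assumes i: "i \<in> S" and fin: "finite S"
  shows "E i * E i = E i"
proof (rule eq_matI)
  fix a b assume "a < dim_row (E i)" "b < dim_col (E i)"
  then have ab: "a < v" "b < v" using carr[OF i] by auto
  have "E i $$ (a, b) = (\<Sum>j\<in>S. (E i * E j) $$ (a, b))"
    by (rule expand[OF carr[OF i] ab])
  also have "\<dots> = (\<Sum>j\<in>S. if j = i then (E i * E i) $$ (a, b) else 0)"
    using ab orthogonal[OF i] by (intro sum.cong) auto
  finally show "(E i * E i) $$ (a, b) = E i $$ (a, b)"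
    using i fin by simp
qed (use carr[OF i] in auto)

lemma commute:
  assumes "X \<in> adjacency_algebra v Bs" "i \<in> S"
  shows "E i * X = X * E i"
proof -
  obtain c where c: "X * E i = c \<cdot>\<^sub>m E i" using eigen assms by blast
  have "E i * X = transpose_mat (X * E i)"
    using assms carr symmetric in_algebra adjacency_algebra_carrier
    by (subst transpose_mult[of _ v v _ v]) auto
  also have "\<dots> = c \<cdot>\<^sub>m transpose_mat (E i)"
    unfolding c by (rule eq_matI) auto
  also have "\<dots> = X * E i"
    by (simp add: symmetric[OF in_algebra[OF assms(2)]] c)
  finally show ?thesis .
qed

text \<open>Both factors act on every \<open>E i\<close> by scalars, hence so does the product, and its expansion is
  a linear combination of the \<open>E i\<close>.\<close>

lemma product_in_algebra:
  assumes X: "X \<in> adjacency_algebra v Bs" and Y: "Y \<in> adjacency_algebra v Bs"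
  shows "X * Y \<in> adjacency_algebra v Bs"
proof -
  have XY: "X \<in> carrier_mat v v" "Y \<in> carrier_mat v v"
    using X Y adjacency_algebra_carrier by auto
  have "\<exists>c. X * Y * E i = c \<cdot>\<^sub>m E i" if i: "i \<in> S" for i
  proof -
    obtain c d where cd: "X * E i = c \<cdot>\<^sub>m E i" "Y * E i = d \<cdot>\<^sub>m E i"
      using eigen X Y i by metis
    have "X * Y * E i = X * (d \<cdot>\<^sub>m E i)"
      using XY carr[OF i] by (simp add: cd assoc_mult_mat[of _ v v _ v _ v])
    also have "\<dots> = d \<cdot>\<^sub>m (c \<cdot>\<^sub>m E i)"
      using XY carr[OF i] by (simp add: cd mult_smult_distrib[of _ v v _ v])
    finally have "X * Y * E i = (d * c) \<cdot>\<^sub>m E i"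
      by (auto simp: intro!: eq_matI)
    then show ?thesis ..
  qed
  then obtain x where x: "\<And>i. i \<in> S \<Longrightarrow> X * Y * E i = x i \<cdot>\<^sub>m E i" by metis
  have "X * Y = mat v v (\<lambda>(a, b). \<Sum>i\<in>S. x i * E i $$ (a, b))"
  proof (rule eq_matI)
    fix a b assume "a < dim_row (mat v v (\<lambda>(a, b). \<Sum>i\<in>S. x i * E i $$ (a, b)))"
      "b < dim_col (mat v v (\<lambda>(a, b). \<Sum>i\<in>S. x i * E i $$ (a, b)))"
    then have ab: "a < v" "b < v" by auto
    have "(X * Y) $$ (a, b) = (\<Sum>i\<in>S. (X * Y * E i) $$ (a, b))"
      by (rule expand) (use XY ab in auto)
    also have "\<dots> = (\<Sum>i\<in>S. x i * E i $$ (a, b))"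
    proof (rule sum.cong[OF refl])
      fix i assume i: "i \<in> S"
      show "(X * Y * E i) $$ (a, b) = x i * E i $$ (a, b)"
        using carr[OF i] ab by (simp add: x[OF i])
    qed
    finally show "(X * Y) $$ (a, b) = mat v v (\<lambda>(a, b). \<Sum>i\<in>S. x i * E i $$ (a, b)) $$ (a, b)"
      using ab by simp
  qed (use XY in auto)
  then show ?thesis using adjacency_algebra_sum[of S E v Bs x] in_algebra by simp
qed

text \<open>The scalar \<open>c\<close> by which an idempotent acts satisfies $c^2 = c$.\<close>

lemma idempotent_component:
  assumes X: "X \<in> adjacency_algebra v Bs" "X * X = X" and i: "i \<in> S"
    and nz: "X * E i \<noteq> 0\<^sub>m v v"
  shows "X * E i = E i"
proof -
  note cE = carr[OF i] and cX = adjacency_algebra_carrier[OF X(1)]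
  obtain c where c: "X * E i = c \<cdot>\<^sub>m E i" using eigen X(1) i by blast
  have c0: "c \<noteq> 0" using nz cE by (auto simp: c)
  have "X * (X * E i) = X * E i"
    using cE cX X(2) by (simp flip: assoc_mult_mat[of _ v v _ v _ v])
  then have "c \<cdot>\<^sub>m (X * E i) = X * E i"
    using cE cX by (simp add: c mult_smult_distrib[of _ v v _ v])
  then have eq: "c \<cdot>\<^sub>m (c \<cdot>\<^sub>m E i) = c \<cdot>\<^sub>m E i" by (simp add: c)
  have "c * E i $$ (a, b) = E i $$ (a, b)" if "a < v" "b < v" for a b
    using arg_cong[OF eq, of "\<lambda>Z. Z $$ (a, b)"] c0 cE that by auto
  then show ?thesis unfolding c using cE by (intro eq_matI) auto
qed

text \<open>If \<open>E i = F + G\<close> with \<open>F * G = 0\<close>, then \<open>F = F * E i\<close> and \<open>G = G * E i\<close> are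
  nonzero components, so both are equal to \<open>E i\<close>, which contradicts \<open>F * G = 0\<close>.\<close>

lemma primitive:
  assumes i: "i \<in> S" and fin: "finite S"
  shows "E i \<in> primitive_idempotents v Bs"
proof -
  note cE = carr[OF i]
  have False
    if FG: "F \<in> adjacency_algebra v Bs" "G \<in> adjacency_algebra v Bs"
      "F \<noteq> 0\<^sub>m v v" "G \<noteq> 0\<^sub>m v v" "F * F = F" "G * G = G" "F * G = 0\<^sub>m v v" "G * F = 0\<^sub>m v v"
      "E i = F + G" for F G
  proof -
    note cF = adjacency_algebra_carrier[OF FG(1)] and cG = adjacency_algebra_carrier[OF FG(2)]
    have F: "F * E i = F" using cF cG FG by (simp add: mult_add_distrib_mat[of _ v v _ v])
    have G: "G * E i = G" using cF cG FG by (simp add: mult_add_distrib_mat[of _ v v _ v])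
    have "F = E i" using idempotent_component[OF FG(1,5) i] F FG(3) by simp
    moreover have "G = E i" using idempotent_component[OF FG(2,6) i] G FG(4) by simp
    ultimately show False using FG(5,7,3) by metis
  qed
  then show ?thesis
    using in_algebra[OF i] nonzero[OF i] idempotent[OF i fin]
    unfolding primitive_idempotents_def by blast
qed

text \<open>A nonzero idempotent \<open>X\<close> has some component \<open>X * E i = E i\<close> and splits as
  \<open>E i + (X - E i)\<close>; primitivity forces the second summand to vanish.\<close>

lemma primitive_only:
  assumes X: "X \<in> primitive_idempotents v Bs" and fin: "finite S"
  shows "X \<in> E ` S"
proof -
  have XA: "X \<in> adjacency_algebra v Bs" and X0: "X \<noteq> 0\<^sub>m v v" and XX: "X * X = X"
    and prim: "\<And>F G. \<lbrakk>F \<in> adjacency_algebra v Bs; G \<in> adjacency_algebra v Bs;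
       F \<noteq> 0\<^sub>m v v; G \<noteq> 0\<^sub>m v v; F * F = F; G * G = G; F * G = 0\<^sub>m v v; G * F = 0\<^sub>m v v;
       X = F + G\<rbrakk> \<Longrightarrow> False"
    using X unfolding primitive_idempotents_def by blast+
  note cX = adjacency_algebra_carrier[OF XA]
  obtain i where i: "i \<in> S" and nz: "X * E i \<noteq> 0\<^sub>m v v"
    using nonzero_component[OF cX X0] by blast
  note cE = carr[OF i] and EE = idempotent[OF i fin]
  have XE: "X * E i = E i" by (rule idempotent_component[OF XA XX i nz])
  have EX: "E i * X = E i" using commute[OF XA i] XE by simp
  let ?G = "X - E i"
  have cG: "?G \<in> carrier_mat v v" using cE by (rule minus_carrier_mat)
  have GE: "?G * E i = 0\<^sub>m v v"
    using cX cE by (simp add: minus_mult_distrib_mat[of _ v v _ _ v] XE EE)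
  have EG: "E i * ?G = 0\<^sub>m v v"
    using cX cE by (simp add: mult_minus_distrib_mat[of _ v v _ v] EX EE)
  have "?G * X = ?G"
    using cX cE by (simp add: minus_mult_distrib_mat[of _ v v _ _ v] XX EX)
  then have GG: "?G * ?G = ?G"
    using cX cE cG GE by (subst mult_minus_distrib_mat[of _ v v _ v]) (auto intro!: eq_matI)
  have split: "X = E i + ?G" using cX cE by (intro eq_matI) auto
  have "?G = 0\<^sub>m v v"
    using prim[OF in_algebra[OF i] adjacency_algebra_minus[OF XA in_algebra[OF i]] nonzero[OF i] _
        EE GG EG GE split] by blast
  have "X = E i"
  proof (rule eq_matI)
    fix a b assume "a < dim_row (E i)" "b < dim_col (E i)"
    then show "X $$ (a, b) = E i $$ (a, b)"
      using arg_cong[OF \<open>?G = 0\<^sub>m v v\<close>, of "\<lambda>Z. Z $$ (a, b)"] cE cX by auto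
  qed (use cX cE in auto)
  then show ?thesis using i by blast
qed

lemma inj:
  assumes fin: "finite S"
  shows "inj_on E S"
  using idempotent[OF _ fin] orthogonal nonzero by (metis inj_onI)

end

text \<open>The adjacency matrices of the partition of the pairs of vertices into the fibres of \<open>\<rho>\<close>.\<close>

definition relation_mats :: "nat \<Rightarrow> nat \<Rightarrow> (nat \<Rightarrow> nat \<Rightarrow> nat) \<Rightarrow> complex mat list" where
  "relation_mats v D \<rho> = map (\<lambda>l. mat v v (\<lambda>(a, b). of_bool (\<rho> a b = l))) [0..<D]"

lemma lin_comb_relation_mats:
  assumes "\<And>a b. a < v \<Longrightarrow> b < v \<Longrightarrow> \<rho> a b < D"
  shows "lin_comb v c (relation_mats v D \<rho>) = mat v v (\<lambda>(a, b). c (\<rho> a b))"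
proof (intro eq_matI)
  fix a b assume "a < dim_row (mat v v (\<lambda>(a, b). c (\<rho> a b)))"
    "b < dim_col (mat v v (\<lambda>(a, b). c (\<rho> a b)))"
  then have ab: "a < v" "b < v" by auto
  have "lin_comb v c (relation_mats v D \<rho>) $$ (a, b) = (\<Sum>l<D. c l * of_bool (\<rho> a b = l))"
    using ab by (simp add: lin_comb_def relation_mats_def)
  also have "\<dots> = (\<Sum>l<D. if l = \<rho> a b then c (\<rho> a b) else 0)"
    by (intro sum.cong) auto
  also have "\<dots> = c (\<rho> a b)" using assms[OF ab] by simp
  finally show "lin_comb v c (relation_mats v D \<rho>) $$ (a, b) = mat v v (\<lambda>(a, b). c (\<rho> a b)) $$ (a, b)"
    using ab by simp
qed (auto simp: lin_comb_def)

lemma symmetric_association_scheme_relation_mats: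
  assumes v: "v > 0"
    and bound: "\<And>a b. a < v \<Longrightarrow> b < v \<Longrightarrow> \<rho> a b < D"
    and sym: "\<And>a b. a < v \<Longrightarrow> b < v \<Longrightarrow> \<rho> a b = \<rho> b a"
    and diag: "\<And>a b. a < v \<Longrightarrow> b < v \<Longrightarrow> \<rho> a b = 0 \<longleftrightarrow> a = b"
    and surj: "\<And>l. l < D \<Longrightarrow> \<exists>a<v. \<exists>b<v. \<rho> a b = l"
    and prod: "\<And>A B. A \<in> adjacency_algebra v (relation_mats v D \<rho>) \<Longrightarrow>
      B \<in> adjacency_algebra v (relation_mats v D \<rho>) \<Longrightarrow>
      A * B \<in> adjacency_algebra v (relation_mats v D \<rho>)"
  shows "symmetric_association_scheme v (relation_mats v D \<rho>)"
proof -
  let ?B = "relation_mats v D \<rho>"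
  have D: "D > 0" using bound[of 0 0] v by simp
  have mem: "A \<in> adjacency_algebra v ?B" if A: "A \<in> set ?B" for A
  proof -
    obtain l where "A = mat v v (\<lambda>(a, b). of_bool (\<rho> a b = l))"
      using A by (auto simp: relation_mats_def)
    then have "A = lin_comb v (\<lambda>k. of_bool (k = l)) ?B"
      using lin_comb_relation_mats[of v \<rho> D "\<lambda>k. of_bool (k = l)"] bound by simp
    then show ?thesis by (auto simp: adjacency_algebra_def)
  qed
  have tr: "transpose_mat A = A" if "A \<in> set ?B" for A
    using that sym by (auto simp: relation_mats_def intro!: eq_matI)
  have nz: "A \<noteq> 0\<^sub>m v v" if A: "A \<in> set ?B" for A
  proof -
    obtain l where l: "l < D" "A = mat v v (\<lambda>(a, b). of_bool (\<rho> a b = l))"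
      using A by (auto simp: relation_mats_def)
    obtain a b where "a < v" "b < v" "\<rho> a b = l" using surj l(1) by blast
    then have "A $$ (a, b) = 1" "(0\<^sub>m v v :: complex mat) $$ (a, b) = 0" by (auto simp: l)
    then show ?thesis by auto
  qed
  have hd: "hd ?B = 1\<^sub>m v"
    using D diag by (auto simp: relation_mats_def hd_map upt_conv_Cons intro!: eq_matI)
  have one: "lin_comb v (\<lambda>_. 1) ?B = all_ones v"
    using bound by (subst lin_comb_relation_mats) (auto simp: all_ones_def)
  have "?B \<noteq> []" using D by (simp add: relation_mats_def)
  moreover have "\<forall>A\<in>set ?B. A \<in> carrier_mat v v \<and> A \<noteq> 0\<^sub>m v v
      \<and> (\<forall>a<v. \<forall>b<v. A $$ (a, b) \<in> {0, 1})"
    using nz by (auto simp: relation_mats_def)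
  moreover have "\<forall>A\<in>set (tl ?B). transpose_mat A \<in> set (tl ?B)"
    using tr list.set_sel(2)[OF \<open>?B \<noteq> []\<close>] by simp
  moreover have "\<forall>A\<in>set ?B. \<forall>B\<in>set ?B. A * B \<in> adjacency_algebra v ?B"
    using mem prod by simp
  moreover have "\<forall>A\<in>set ?B. transpose_mat A = A"
    using tr by simp
  ultimately show ?thesis
    unfolding symmetric_association_scheme_def association_scheme_def
    using hd one by (intro conjI)
qed

section \<open>Characters of the cyclic group and even functions\<close>

text \<open>The character $\chi_k$ of $\mathbb{Z}_m$ with both arguments taken as arbitrary integers, so that
  $\chi_{-k}$ and differences of positions need no reduction modulo $m$.\<close>

definition add_char :: "nat \<Rightarrow> int \<Rightarrow> int \<Rightarrow> complex" where
  "add_char m k t = cis (2 * pi * (of_int (k * t) / of_nat m))"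

lemma add_char_0 [simp]: "add_char m 0 t = 1" "add_char m k 0 = 1"
  by (simp_all add: add_char_def)

lemma add_char_add: "add_char m k (s + t) = add_char m k s * add_char m k t"
  by (simp add: add_char_def cis_mult algebra_simps add_divide_distrib)

lemma add_char_add_left: "add_char m (k + l) t = add_char m k t * add_char m l t"
  by (simp add: add_char_def cis_mult algebra_simps add_divide_distrib)

lemma add_char_minus: "add_char m k (- t) = add_char m (- k) t"
  by (simp add: add_char_def)

lemma add_char_commute: "add_char m k t = add_char m t k"
  by (simp add: add_char_def mult.commute)

lemma add_char_nat: "add_char m k (int t) = add_char m k 1 ^ t"
  by (induction t) (simp_all add: add_char_add mult.commute)

lemma add_char_eq_1:
  assumes "m > 0" "int m dvd t"
  shows "add_char m k t = 1"
proof -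
  obtain r where "t = int m * r" using assms by auto
  then have "of_int (k * t) / of_nat m = (of_int (k * r) :: real)" using assms by simp
  then show ?thesis unfolding add_char_def by (metis Ints_of_int cis_multiple_2pi)
qed

lemma add_char_periodic: "m > 0 \<Longrightarrow> add_char m k (t + int m) = add_char m k t"
  by (simp add: add_char_add add_char_eq_1)

lemma add_char_1_eq_1_iff:
  assumes "m > 0"
  shows "add_char m k 1 = 1 \<longleftrightarrow> int m dvd k"
proof
  assume "add_char m k 1 = 1"
  then have "cos (2 * pi * (of_int k / of_nat m)) = 1" by (simp add: add_char_def complex_eq_iff)
  then obtain r :: int where "2 * pi * (of_int k / of_nat m) = of_int r * 2 * pi"
    unfolding cos_one_2pi_int by blast
  then have "of_int k = (of_int (r * int m) :: real)" using assms by (simp add: field_simps)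
  then have "k = r * int m" by linarith
  then show "int m dvd k" by simp
next
  assume "int m dvd k"
  then show "add_char m k 1 = 1" using assms by (subst add_char_commute) (rule add_char_eq_1)
qed

lemma sum_add_char:
  assumes "m > 0"
  shows "(\<Sum>t<m. add_char m k (int t)) = (if int m dvd k then of_nat m else 0)"
proof (cases "int m dvd k")
  case True
  then have "add_char m k (int t) = 1" for t
    using assms add_char_1_eq_1_iff[of m k] by (simp add: add_char_nat)
  with True show ?thesis by simp
next
  case False
  let ?z = "add_char m k 1"
  have "?z \<noteq> 1" using False assms add_char_1_eq_1_iff by blast
  moreover have "?z ^ m = 1" using assms add_char_eq_1[of m "int m" k] by (simp add: add_char_nat)
  ultimately show ?thesis using False by (simp add: add_char_nat geometric_sum)
qed

text \<open>Functions on $\mathbb{Z}_m$ that are constant on the classes $\{t, -t\}$, as functions on the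
  integers.\<close>

locale even_periodic =
  fixes m :: nat and f :: "int \<Rightarrow> complex"
  assumes m_pos: "m > 0"
    and even: "f (- t) = f t"
    and periodic: "f (t + int m) = f t"
begin

lemma cong:
  assumes "[s = t] (mod int m)"
  shows "f s = f t"
proof -
  have step: "f (x + int r * int m) = f x" for x r
  proof (induction r)
    case (Suc r)
    have "f (x + int (Suc r) * int m) = f (x + int r * int m + int m)" by (simp add: algebra_simps)
    with Suc show ?case by (simp only: periodic)
  qed simp
  have *: "f (x mod int m) = f x" for x
  proof (cases "x \<ge> 0")
    case True
    then show ?thesis
      using step[of "x mod int m" "nat (x div int m)"] m_pos
      by (simp add: pos_imp_zdiv_nonneg_iff)
  next
    case False
    then have "x div int m \<le> 0" using m_pos
      by (metis div_neg_pos_less0 linorder_not_le nle_le of_nat_0_less_iff order_less_le)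
    then show ?thesis
      using step[of x "nat (- (x div int m))"] minus_div_mult_eq_mod[of x "int m"] by simp
  qed
  show ?thesis using assms *[of s] *[of t] by (simp add: cong_def)
qed

lemma cong_minus:
  assumes "[s = - t] (mod int m)"
  shows "f s = f t"
  using cong[OF assms] even by simp

end

text \<open>A map that is injective on residues permutes a complete residue system.\<close>

lemma sum_residues_reindex:
  fixes f :: "int \<Rightarrow> complex"
  assumes m: "m > 0" and per: "\<And>s t. [s = t] (mod int m) \<Longrightarrow> f s = f t"
    and inj: "\<And>s t. [\<phi> s = \<phi> t] (mod int m) \<Longrightarrow> [s = t] (mod int m)"
  shows "(\<Sum>t<m. f (\<phi> (int t))) = (\<Sum>t<m. f (int t))"
proof -
  let ?h = "\<lambda>t. nat (\<phi> (int t) mod int m)"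
  have "inj_on ?h {..<m}"
  proof (rule inj_onI)
    fix s t assume st: "s \<in> {..<m}" "t \<in> {..<m}" "?h s = ?h t"
    then have "[\<phi> (int s) = \<phi> (int t)] (mod int m)"
      using m by (simp add: cong_def nat_eq_iff)
    then have "[int s = int t] (mod int m)" by (rule inj)
    with st show "s = t" by (simp add: cong_def)
  qed
  moreover have into: "?h ` {..<m} \<subseteq> {..<m}"
    using m by (auto simp: nat_less_iff)
  ultimately have "bij_betw ?h {..<m} {..<m}"
    by (simp add: bij_betw_def endo_inj_surj)
  then have "(\<Sum>t<m. f (int (?h t))) = (\<Sum>t<m. f (int t))"
    by (rule sum.reindex_bij_betw)
  moreover have "f (int (?h t)) = f (\<phi> (int t))" for t
    using m by (intro per) (simp add: cong_def)
  ultimately show ?thesis by (simp only:)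
qed

definition fourier :: "nat \<Rightarrow> (int \<Rightarrow> complex) \<Rightarrow> int \<Rightarrow> complex" where
  "fourier m f k = (\<Sum>u<m. f (int u) * add_char m k (int u))"

text \<open>The sum of the distinct characters among $\chi_k$ and $\chi_{-k}$.  These sums for
  $0 \<le> k \<le> m/2$ are pairwise orthogonal and add up to the regular character.\<close>

definition theta :: "nat \<Rightarrow> int \<Rightarrow> int \<Rightarrow> complex" where
  "theta m k t = (if int m dvd 2 * k then add_char m k t else add_char m k t + add_char m (- k) t)"

lemma add_char_cong:
  assumes "m > 0" "[s = t] (mod int m)"
  shows "add_char m k s = add_char m k t"
  using add_char_add[of m k t "s - t"] add_char_eq_1[of m "s - t" k] assms
  by (simp add: cong_iff_dvd_diff)

lemma add_char_minus_self:
  assumes "m > 0" "int m dvd 2 * k"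
  shows "add_char m (- k) t = add_char m k t"
proof -
  have "add_char m (2 * k + (- k)) t = add_char m (- k) t"
    unfolding add_char_add_left[of m "2 * k"] add_char_commute[of m "2 * k"] using add_char_eq_1[OF assms] by simp
  then show ?thesis by simp
qed

lemma even_periodic_theta:
  assumes "m > 0"
  shows "even_periodic m (theta m k)"
  using assms by unfold_locales (auto simp: theta_def add_char_minus add_char_periodic add_char_minus_self)

context even_periodic
begin

lemma fourier_minus: "fourier m f (- k) = fourier m f k"
proof -
  have "(\<Sum>u<m. f (- int u) * add_char m k (- int u)) = (\<Sum>u<m. f (int u) * add_char m k (int u))"
    using m_pos
    by (intro sum_residues_reindex[where f = "\<lambda>u. f u * add_char m k u" and \<phi> = uminus])
      (auto simp: cong_minus_minus_iff intro!: arg_cong2[where f = "(*)"] cong add_char_cong)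
  then show ?thesis by (simp add: fourier_def even add_char_minus)
qed

text \<open>Substituting $u = y + s$ leaves $\sum_u f(u) \chi_k(u)$ times the constant $\chi_k(t - s)$.\<close>

lemma convolution_add_char:
  "(\<Sum>y<m. f (int y + s) * add_char m k (int y + t)) = fourier m f k * add_char m k (t - s)"
proof -
  have "(\<Sum>y<m. f (int y + s) * add_char m k (int y + s)) = fourier m f k"
    unfolding fourier_def using m_pos
    by (intro sum_residues_reindex[where f = "\<lambda>u. f u * add_char m k u" and \<phi> = "\<lambda>y. y + s"])
      (auto simp: cong_add_rcancel intro!: arg_cong2[where f = "(*)"] cong add_char_cong)
  moreover have "add_char m k (int y + t) = add_char m k (int y + s) * add_char m k (t - s)" for y
    by (simp flip: add_char_add)
  ultimately show ?thesis
    by (simp only: mult.assoc[symmetric] sum_distrib_right[symmetric])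
qed

text \<open>For even $f$ the two characters $\chi_k, \chi_{-k}$ have the same Fourier coefficient, so
  $\theta_k$ is again an eigenfunction of convolution with $f$.\<close>

lemma convolution_theta:
  "(\<Sum>y<m. f (int y + s) * theta m k (int y + t)) = fourier m f k * theta m k (t - s)"
  using convolution_add_char[of s k t] convolution_add_char[of s "- k" t]
  by (simp add: theta_def distrib_left sum.distrib fourier_minus)

end

lemma sum_theta:
  assumes "m > 0"
  shows "(\<Sum>t<m. theta m k (int t)) = (if int m dvd k then of_nat m else 0)"
  using sum_add_char[OF assms, of k] sum_add_char[OF assms, of "- k"]
  by (cases "int m dvd 2 * k") (auto simp: theta_def sum.distrib)

text \<open>In the range $0 \<le> k, l \<le> m/2$ the congruence $l \equiv \pm k$ means $k = l$; if the
  minus sign occurs with $k = l$, then $2k \equiv 0$ and $\theta_k$ consists of one character only.\<close>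

lemma fourier_theta:
  assumes m: "m > 0" and k: "k \<le> m div 2" and l: "l \<le> m div 2"
  shows "fourier m (theta m (int k)) (int l) = (if k = l then of_nat m else 0)"
proof -
  have sums: "(\<Sum>u<m. add_char m (int k) (int u) * add_char m (int l) (int u))
      = (if int m dvd int k + int l then of_nat m else 0)"
    "(\<Sum>u<m. add_char m (- int k) (int u) * add_char m (int l) (int u))
      = (if int m dvd int l - int k then of_nat m else 0)"
    using sum_add_char[OF m, of "int k + int l"] sum_add_char[OF m, of "- int k + int l"]
    unfolding add_char_add_left by simp_all
  have diff: "int m dvd int l - int k \<longleftrightarrow> k = l"
  proof
    assume "int m dvd int l - int k"
    moreover have "\<bar>int l - int k\<bar> < int m" using m k l by linarith
    ultimately show "k = l" using zdvd_not_zless[of "\<bar>int l - int k\<bar>" "int m"] by force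
  qed simp
  show ?thesis
  proof (cases "int m dvd 2 * int k")
    case True
    have "int m dvd int k + int l \<longleftrightarrow> int m dvd int l - int k"
      using dvd_diff[OF _ True, of "int k + int l"] dvd_add[OF _ True, of "int l - int k"]
      by (auto simp: algebra_simps)
    with True sums diff show ?thesis by (simp add: fourier_def theta_def)
  next
    case False
    have "\<not> int m dvd int k + int l"
    proof
      assume dv: "int m dvd int k + int l"
      have "k > 0" using False by (cases k) auto
      then have "int m \<le> int k + int l" using dv by (intro zdvd_imp_le) auto
      then have "2 * int k = int m" using k l by linarith
      with False show False by simp
    qed
    with False sums diff show ?thesis
      by (simp add: fourier_def theta_def distrib_right sum.distrib)
  qed
qed

text \<open>As $k$ runs over $0, \dots, \lfloor m/2 \rfloor$ the terms $\chi_k$ and $\chi_{-k}$ of the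
  $\theta_k$ run over all $m$ characters, each once.\<close>

lemma sum_theta_index:
  assumes m: "m > 0"
  shows "(\<Sum>k\<le>m div 2. theta m (int k) t) = (if int m dvd t then of_nat m else 0)"
proof -
  let ?h = "m div 2"
  \<comment> \<open>The proper pairs $\{k, -k\}$ are those with $1 \<le> k < m - \lfloor m/2 \rfloor$, for either parity of $m$.\<close>
  have self: "int m dvd 2 * int k \<longleftrightarrow> k \<notin> {1..<m - ?h}" if "k \<le> ?h" for k
  proof
    assume dv: "int m dvd 2 * int k"
    show "k \<notin> {1..<m - ?h}"
    proof
      assume "k \<in> {1..<m - ?h}"
      then have "0 < 2 * int k" "2 * int k < int m" by auto
      with dv show False using zdvd_not_zless by blast
    qed
  next
    assume "k \<notin> {1..<m - ?h}"
    then have "k = 0 \<or> 2 * k = m" using that by auto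
    then show "int m dvd 2 * int k" by auto
  qed
  have "(\<Sum>k\<le>?h. theta m (int k) t)
      = (\<Sum>k\<le>?h. add_char m (int k) t) + (\<Sum>k\<le>?h. if k \<in> {1..<m - ?h} then add_char m (- int k) t else 0)"
    unfolding sum.distrib[symmetric] by (rule sum.cong[OF refl]) (auto simp: theta_def self)
  also have "(\<Sum>k\<le>?h. if k \<in> {1..<m - ?h} then add_char m (- int k) t else 0)
      = (\<Sum>k\<in>{1..<m - ?h}. add_char m (- int k) t)"
    by (subst sum.inter_restrict[symmetric]) (auto intro!: sum.cong)
  also have "\<dots> = (\<Sum>k\<in>{?h<..<m}. add_char m (int k) t)"
  proof (rule sum.reindex_bij_witness[of _ "\<lambda>k. m - k" "\<lambda>k. m - k"])
    fix k assume "k \<in> {1..<m - ?h}"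
    then have "int (m - k) = - int k + int m" by (subst of_nat_diff) auto
    then show "add_char m (int (m - k)) t = add_char m (- int k) t"
      using add_char_periodic[OF m, of t "- int k"] by (simp add: add_char_commute[of m _ t])
  qed auto
  also have "(\<Sum>k\<le>?h. add_char m (int k) t) + \<dots> = (\<Sum>k<m. add_char m (int k) t)"
    using m by (subst sum.union_disjoint[symmetric]) (auto intro!: sum.cong)
  also have "\<dots> = (if int m dvd t then of_nat m else 0)"
    using sum_add_char[OF m, of t] by (simp add: add_char_commute[of m _ t])
  finally show ?thesis .
qed

section \<open>The matrix algebra of a balanced family of weights\<close>

lemma sum_blocks:
  fixes F :: "nat \<Rightarrow> nat \<Rightarrow> complex"
  assumes "m > 0"
  shows "(\<Sum>a<r * m. F (a div m) (a mod m)) = (\<Sum>i<r. \<Sum>x<m. F i x)"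
proof -
  have "(\<Sum>a\<in>{i * m..<i * m + m}. F (a div m) (a mod m)) = (\<Sum>x<m. F i x)" for i
  proof (rule sum.reindex_bij_witness[of _ "\<lambda>x. i * m + x" "\<lambda>a. a - i * m"])
    fix a assume a: "a \<in> {i * m..<i * m + m}"
    then have "a div m = i" by (intro div_nat_eqI) (auto simp: algebra_simps)
    moreover from this have "a mod m = a - i * m" using minus_div_mult_eq_mod[of a m] by simp
    ultimately show "F i (a - i * m) = F (a div m) (a mod m)" by simp
  qed auto
  then show ?thesis by (simp flip: sum.nat_group)
qed

text \<open>The exponents of a symmetric balanced generalized weighing matrix with zero diagonal:
  $w_{ij} = U^{e(i,j)}$ for $i \<noteq> j$.\<close>

locale cyclic_weights =
  fixes n m :: nat and e :: "nat \<Rightarrow> nat \<Rightarrow> int"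
  assumes n_pos: "n > 0" and m_pos: "m > 0"
    and e_sym: "i \<le> n \<Longrightarrow> j \<le> n \<Longrightarrow> e i j = e j i"
    and balanced: "i \<le> n \<Longrightarrow> h \<le> n \<Longrightarrow> i \<noteq> h \<Longrightarrow>
      m * card {j. j \<le> n \<and> j \<noteq> i \<and> j \<noteq> h \<and> [e i j - e h j = t] (mod int m)} = n - 1"
begin

text \<open>As $j$ runs over the remaining blocks, $e(i,j) - e(h,j)$ takes every residue equally often, so the
  sum is a multiple of the sum over $\mathbb{Z}_m$.  The factor $m$ on the left avoids the fraction
  $(n-1)/m$.\<close>

lemma balanced_sum:
  assumes F: "\<And>s t. [s = t] (mod int m) \<Longrightarrow> F s = F t"
    and ih: "i \<le> n" "h \<le> n" "i \<noteq> h"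
  shows "of_nat m * (\<Sum>j\<in>{..n} - {i, h}. F (e i j - e h j)) = of_nat (n - 1) * (\<Sum>t<m. F (int t) :: complex)"
proof -
  let ?J = "{..n} - {i, h}"
  let ?r = "\<lambda>j. nat ((e i j - e h j) mod int m)"
  have "(\<Sum>j\<in>?J. F (e i j - e h j)) = (\<Sum>t<m. \<Sum>j\<in>{j \<in> ?J. ?r j = t}. F (e i j - e h j))"
    using m_pos by (intro sum.group[symmetric]) (auto simp: nat_less_iff)
  also have "\<dots> = (\<Sum>t<m. \<Sum>j\<in>{j. j \<le> n \<and> j \<noteq> i \<and> j \<noteq> h \<and> [e i j - e h j = int t] (mod int m)}. F (int t))"
    using m_pos by (intro sum.cong F) (auto simp: cong_def nat_eq_iff)
  finally have "(\<Sum>j\<in>?J. F (e i j - e h j))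
    = (\<Sum>t<m. of_nat (card {j. j \<le> n \<and> j \<noteq> i \<and> j \<noteq> h \<and> [e i j - e h j = int t] (mod int m)}) * F (int t))"
    by simp
  then have "of_nat m * (\<Sum>j\<in>?J. F (e i j - e h j))
    = (\<Sum>t<m. of_nat (m * card {j. j \<le> n \<and> j \<noteq> i \<and> j \<noteq> h \<and> [e i j - e h j = int t] (mod int m)}) * F (int t))"
    by (simp add: sum_distrib_left mult.assoc)
  also have "\<dots> = of_nat (n - 1) * (\<Sum>t<m. F (int t))"
    by (simp only: balanced[OF ih] sum_distrib_left)
  finally show ?thesis .
qed

text \<open>For functions $f, g$ on $\mathbb{Z}_m$ this is $\sum_l f(l) A_{l,0} + \sum_l g(-l) A_{l,1}$.\<close>

definition algebra_mat :: "(int \<Rightarrow> complex) \<Rightarrow> (int \<Rightarrow> complex) \<Rightarrow> complex mat" where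
  "algebra_mat f g = mat ((n + 1) * m) ((n + 1) * m) (\<lambda>(a, b).
     if a div m = b div m then f (int (b mod m) - int (a mod m))
     else g (int (a mod m) + int (b mod m) + e (a div m) (b div m) + 1))"

lemma algebra_mat_carrier [simp]: "algebra_mat f g \<in> carrier_mat ((n + 1) * m) ((n + 1) * m)"
  "dim_row (algebra_mat f g) = (n + 1) * m" "dim_col (algebra_mat f g) = (n + 1) * m"
  by (simp_all add: algebra_mat_def)

lemma algebra_mat_index:
  assumes "a < (n + 1) * m" "b < (n + 1) * m"
  shows "algebra_mat f g $$ (a, b) = (if a div m = b div m then f (int (b mod m) - int (a mod m))
     else g (int (a mod m) + int (b mod m) + e (a div m) (b div m) + 1))"
  using assms by (simp add: algebra_mat_def)

text \<open>A path from block $i$ to block $h$ through block $j$ contributes the convolution of the two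
  functions attached to the pairs $(i,j)$ and $(j,h)$.  For $i = h$ the $n$ blocks $j \<noteq> i$ all
  contribute the same amount, because the exponent $e(i,j)$ cancels.  For $i \<noteq> h$ the blocks
  $j = i$ and $j = h$ contribute $d \hat f(k)$ and $\hat g(k)$, and the others together
  $(n-1) d\, \hat g(k)$ if $k = 0$ in $\mathbb{Z}_m$ and nothing otherwise; the equation for $d$ says precisely that the
  result is $d$ times the factor found for $i = h$.\<close>

lemma algebra_mat_mult_theta:
  assumes "even_periodic m f" "even_periodic m g"
    and d: "of_nat n * d\<^sup>2 = 1 + (if int m dvd k then of_nat (n - 1) * d else 0)"
  shows "algebra_mat f g * algebra_mat (theta m k) (\<lambda>t. d * theta m k t)
    = (fourier m f k + of_nat n * d * fourier m g k) \<cdot>\<^sub>m algebra_mat (theta m k) (\<lambda>t. d * theta m k t)"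
    (is "_ = ?c \<cdot>\<^sub>m ?T")
proof (rule eq_matI)
  interpret f: even_periodic m f by fact
  interpret g: even_periodic m g by fact
  interpret t: even_periodic m "theta m k" using even_periodic_theta[OF m_pos] .
  let ?v = "(n + 1) * m" and ?\<theta> = "theta m k"
  let ?f = "fourier m f k" and ?g = "fourier m g k"
  fix a b assume "a < dim_row (?c \<cdot>\<^sub>m ?T)" "b < dim_col (?c \<cdot>\<^sub>m ?T)"
  then have ab: "a < ?v" "b < ?v" by auto
  define i x h z where ix: "i = a div m" "x = a mod m" "h = b div m" "z = b mod m"
  have ih: "i \<le> n" "h \<le> n"
    using ab by (auto simp: ix less_mult_imp_div_less less_Suc_eq_le[symmetric] simp del: less_Suc_eq_le)
  \<comment> \<open>The contribution of all paths through block $j$.\<close>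
  define T where "T j = (\<Sum>y<m.
     (if i = j then f (int y - int x) else g (int x + int y + e i j + 1)) *
     (if j = h then ?\<theta> (int z - int y) else d * ?\<theta> (int y + int z + e j h + 1)))" for j
  have "(algebra_mat f g * ?T) $$ (a, b) = (\<Sum>c<?v. algebra_mat f g $$ (a, c) * ?T $$ (c, b))"
    using ab by (simp add: scalar_prod_def lessThan_atLeast0 del: mult_Suc)
  also have "\<dots> = (\<Sum>c<?v. (\<lambda>j y. (if i = j then f (int y - int x) else g (int x + int y + e i j + 1)) *
     (if j = h then ?\<theta> (int z - int y) else d * ?\<theta> (int y + int z + e j h + 1))) (c div m) (c mod m))"
    using ab by (intro sum.cong refl) (simp add: algebra_mat_index ix)
  also have "\<dots> = (\<Sum>j<n + 1. T j)"
    unfolding T_def by (rule sum_blocks[OF m_pos])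
  also have "\<dots> = (\<Sum>j\<le>n. T j)" by (simp add: lessThan_Suc_atMost)
  finally have prod: "(algebra_mat f g * ?T) $$ (a, b) = (\<Sum>j\<le>n. T j)" .
  have conv_f: "(\<Sum>y<m. f (int y - int x) * ?\<theta> (int y + s)) = ?f * ?\<theta> (s + int x)" for s
    using f.convolution_theta[of "- int x" k s] by simp
  have conv_g: "(\<Sum>y<m. g (int x + int y + r + 1) * ?\<theta> (int y + s)) = ?g * ?\<theta> (s - int x - r - 1)" for r s
    using g.convolution_theta[of "int x + r + 1" k s] by (simp add: algebra_simps)
  have swap: "?\<theta> (int z - int y) = ?\<theta> (int y - int z)" for y
    by (rule t.cong_minus) simp
  show "(algebra_mat f g * ?T) $$ (a, b) = (?c \<cdot>\<^sub>m ?T) $$ (a, b)"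
  proof (cases "i = h")
    case True
    have "T i = ?f * ?\<theta> (int z - int x)"
      using conv_f[of "- int z"] True by (simp add: T_def swap)
    moreover have "T j = d * ?g * ?\<theta> (int z - int x)" if "j \<in> {..n} - {i}" for j
    proof -
      have "T j = d * (\<Sum>y<m. g (int x + int y + e i j + 1) * ?\<theta> (int y + (int z + e j h + 1)))"
        using that True by (auto simp: T_def sum_distrib_left algebra_simps intro!: sum.cong)
      also have "\<dots> = d * (?g * ?\<theta> (int z - int x))"
        unfolding conv_g using that ih True e_sym[of i j] by simp
      finally show ?thesis by simp
    qed
    ultimately have "(\<Sum>j\<le>n. T j) = ?c * ?\<theta> (int z - int x)"
      using ih by (simp add: sum.remove[of "{..n}" i] algebra_simps)
    then show ?thesis using prod True ab by (simp add: algebra_mat_index ix)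
  next
    case False
    let ?w = "?\<theta> (int x + int z + e i h + 1)"
    have Ti: "T i = d * ?f * ?w"
    proof -
      have "T i = d * (\<Sum>y<m. f (int y - int x) * ?\<theta> (int y + (int z + e i h + 1)))"
        using False by (auto simp: T_def sum_distrib_left algebra_simps intro!: sum.cong)
      then show ?thesis unfolding conv_f by (simp add: algebra_simps)
    qed
    have Th: "T h = ?g * ?w"
    proof -
      have "T h = ?g * ?\<theta> (- int z - int x - e i h - 1)"
        using conv_g[of "e i h" "- int z"] False by (simp add: T_def swap)
      also have "\<dots> = ?g * ?w"
      proof -
        have "- int z - int x - e i h - 1 = - (int x + int z + e i h + 1)" by linarith
        then show ?thesis by (simp only: t.even)
      qed
      finally show ?thesis .
    qed
    let ?F = "\<lambda>u. ?\<theta> (u + (int x - int z))"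
    have Tj: "T j = d * ?g * ?F (e i j - e h j)" if "j \<in> {..n} - {i, h}" for j
    proof -
      have "T j = d * (\<Sum>y<m. g (int x + int y + e i j + 1) * ?\<theta> (int y + (int z + e j h + 1)))"
        using that by (auto simp: T_def sum_distrib_left algebra_simps intro!: sum.cong)
      also have "\<dots> = d * (?g * ?\<theta> (int z + e j h + 1 - int x - e i j - 1))"
        unfolding conv_g ..
      also have "?\<theta> (int z + e j h + 1 - int x - e i j - 1) = ?F (e i j - e h j)"
      proof -
        have "e j h = e h j" using that ih by (intro e_sym) auto
        then have "int z + e j h + 1 - int x - e i j - 1 = - (e i j - e h j + (int x - int z))"
          by linarith
        then show ?thesis by (simp only: t.even)
      qed
      finally show ?thesis by simp
    qed
    have "of_nat m * (\<Sum>j\<in>{..n} - {i, h}. ?F (e i j - e h j)) = of_nat (n - 1) * (\<Sum>t<m. ?F (int t))"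
      using ih False by (intro balanced_sum t.cong) (simp_all add: cong_add_rcancel)
    also have "(\<Sum>t<m. ?F (int t)) = (if int m dvd k then of_nat m else 0)"
      unfolding sum_theta[OF m_pos, symmetric]
      by (rule sum_residues_reindex[where \<phi> = "\<lambda>t. t + (int x - int z)"])
        (use m_pos t.cong in \<open>simp_all add: cong_add_rcancel\<close>)
    finally have F: "(\<Sum>j\<in>{..n} - {i, h}. ?F (e i j - e h j)) = (if int m dvd k then of_nat (n - 1) else 0)"
      using m_pos by (auto split: if_splits)
    \<comment> \<open>The third blocks contribute a constant; for $k = 0$ it is a multiple of $\theta_k$, which is then $1$.\<close>
    have w1: "?w = 1" if "int m dvd k"
      using that add_char_eq_1[OF m_pos that] by (simp add: theta_def add_char_commute[of m k])
    have "(\<Sum>j\<le>n. T j) = T i + (T h + (\<Sum>j\<in>{..n} - {i, h}. T j))"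
    proof -
      have "{..n} - {i} - {h} = {..n} - {i, h}" by auto
      then show ?thesis using ih False
        by (simp add: sum.remove[of "{..n}" i] sum.remove[of "{..n} - {i}" h])
    qed
    also have "(\<Sum>j\<in>{..n} - {i, h}. T j) = d * ?g * (if int m dvd k then of_nat (n - 1) else 0)"
      by (simp only: F[symmetric] sum_distrib_left sum.cong[OF refl Tj])
    also have "\<dots> = ?g * (of_nat n * d\<^sup>2 - 1) * ?w"
      unfolding d using w1 by auto
    also have "T i + (T h + \<dots>) = ?c * (d * ?w)"
      unfolding Ti Th by (simp add: algebra_simps power2_eq_square)
    finally show ?thesis using prod False ab by (simp add: algebra_mat_index ix)
  qed
qed auto

end

section \<open>The symmetric classes and their idempotents\<close>

text \<open>The representative in $\{0, \dots, \lfloor m/2 \rfloor\}$ of the class $\{t, -t\}$ of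
  $\mathbb{Z}_m$.\<close>

definition rep :: "nat \<Rightarrow> int \<Rightarrow> nat" where
  "rep m t = nat (min (t mod int m) ((- t) mod int m))"

lemma rep_minus [simp]: "rep m (- t) = rep m t"
  by (simp add: rep_def min.commute)

lemma rep_cong: "[s = t] (mod int m) \<Longrightarrow> rep m s = rep m t"
  unfolding rep_def by (metis cong_def cong_minus_minus_iff)

lemma rep_cases:
  assumes "m > 0"
  shows "[int (rep m t) = t] (mod int m) \<or> [int (rep m t) = - t] (mod int m)"
proof -
  have "t mod int m \<ge> 0" "(- t) mod int m \<ge> 0" using assms by auto
  then have "int (rep m t) = t mod int m \<or> int (rep m t) = (- t) mod int m"
    by (auto simp: rep_def min_def)
  then show ?thesis by (auto simp: cong_def)
qed

lemma rep_le:
  assumes "m > 0"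
  shows "rep m t \<le> m div 2"
proof (cases "t mod int m = 0")
  case True
  then show ?thesis by (simp add: rep_def)
next
  case False
  then have "(- t) mod int m = int m - t mod int m" by (simp add: zmod_zminus1_eq_if)
  then show ?thesis by (simp add: rep_def)
qed

lemma rep_of_small:
  assumes "m > 0" "l \<le> m div 2"
  shows "rep m (int l) = l"
proof (cases "l = 0")
  case True
  then show ?thesis by (simp add: rep_def)
next
  case False
  have "int l mod int m = int l" using assms False by simp
  moreover from this have "(- int l) mod int m = int m - int l" using False by (simp add: zmod_zminus1_eq_if)
  ultimately show ?thesis using assms by (simp add: rep_def)
qed

lemma rep_eq_iff:
  assumes "m > 0" "l \<le> m div 2"
  shows "rep m t = l \<longleftrightarrow> [t = int l] (mod int m) \<or> [t = - int l] (mod int m)"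
proof
  assume "rep m t = l"
  then show "[t = int l] (mod int m) \<or> [t = - int l] (mod int m)"
    using rep_cases[OF assms(1), of t] by (metis cong_minus_minus_iff cong_sym minus_minus)
next
  assume "[t = int l] (mod int m) \<or> [t = - int l] (mod int m)"
  then have "rep m t = rep m (int l)" using rep_cong rep_minus by metis
  then show "rep m t = l" using rep_of_small[OF assms] by simp
qed

lemma (in even_periodic) rep: "f (int (rep m t)) = f t"
  using rep_cases[OF m_pos, of t] cong cong_minus by blast

lemma even_periodic_rep:
  assumes "m > 0"
  shows "even_periodic m (\<lambda>t. c (rep m t))"
  using assms by unfold_locales (simp_all add: rep_cong[of "t + int m" t for t] cong_def)

context cyclic_weights
begin

abbreviation v :: nat where "v \<equiv> (n + 1) * m"
abbreviation h :: nat where "h \<equiv> m div 2"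

text \<open>The index of the adjacency matrix that has a $1$ at the given pair, for the order in which the
  matrices formed from the $A_{l,0}$ precede those formed from the $A_{l,1}$.\<close>

definition rho :: "nat \<Rightarrow> nat \<Rightarrow> nat" where
  "rho a b = (if a div m = b div m then rep m (int (b mod m) - int (a mod m))
     else h + 1 + rep m (int (a mod m) + int (b mod m) + e (a div m) (b div m) + 1))"

definition adj_mats :: "complex mat list" where
  "adj_mats = relation_mats v (2 * (h + 1)) rho"

lemma rho_less: "rho a b < 2 * (h + 1)"
proof -
  have small: "rep m t < h + 1" for t using rep_le[OF m_pos, of t] by simp
  show ?thesis
    using small[of "int (b mod m) - int (a mod m)"]
      small[of "int (a mod m) + int (b mod m) + e (a div m) (b div m) + 1"]
    by (simp add: rho_def)
qed

lemma lin_comb_adj_mats: "lin_comb v c adj_mats = mat v v (\<lambda>(a, b). c (rho a b))"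
  unfolding adj_mats_def by (rule lin_comb_relation_mats) (rule rho_less)

lemma algebra_mat_eq_lin_comb:
  assumes "even_periodic m f" "even_periodic m g"
  shows "algebra_mat f g = lin_comb v (\<lambda>l. if l \<le> h then f (int l) else g (int (l - (h + 1)))) adj_mats"
proof -
  interpret f: even_periodic m f by fact
  interpret g: even_periodic m g by fact
  show ?thesis
    unfolding lin_comb_adj_mats using rep_le[OF m_pos]
    by (intro eq_matI) (auto simp: algebra_mat_index rho_def f.rep g.rep)
qed

lemma algebra_mat_in_algebra:
  assumes "even_periodic m f" "even_periodic m g"
  shows "algebra_mat f g \<in> adjacency_algebra v adj_mats"
  using algebra_mat_eq_lin_comb[OF assms] by (auto simp: adjacency_algebra_def)

text \<open>Coefficients on the classes are the same as even functions, by composition with the choice of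
  representatives.\<close>

lemma adjacency_algebraE:
  assumes "X \<in> adjacency_algebra v adj_mats"
  obtains f g where "even_periodic m f" "even_periodic m g" "X = algebra_mat f g"
proof -
  obtain c where c: "X = lin_comb v c adj_mats" using assms by (auto simp: adjacency_algebra_def)
  have "X = algebra_mat (\<lambda>t. c (rep m t)) (\<lambda>t. c (h + 1 + rep m t))"
    unfolding c lin_comb_adj_mats by (intro eq_matI) (auto simp: algebra_mat_index rho_def)
  with even_periodic_rep[OF m_pos, of c] even_periodic_rep[OF m_pos, of "\<lambda>l. c (h + 1 + l)"]
  show thesis by (rule that)
qed

lemma block_index: "a < v \<Longrightarrow> a div m \<le> n"
  using less_mult_imp_div_less[of a "n + 1" m] by simp

lemma algebra_mat_symmetric:
  assumes "even_periodic m f"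
  shows "transpose_mat (algebra_mat f g) = algebra_mat f g"
proof (rule eq_matI)
  interpret f: even_periodic m f by fact
  fix a b assume "a < dim_row (algebra_mat f g)" "b < dim_col (algebra_mat f g)"
  then have ab: "a < v" "b < v" by auto
  then show "transpose_mat (algebra_mat f g) $$ (a, b) = algebra_mat f g $$ (a, b)"
    using e_sym[OF block_index block_index, OF ab] f.even[of "int (b mod m) - int (a mod m)"]
    by (simp add: algebra_mat_index algebra_simps)
qed auto

text \<open>The solutions $d$ of $n d^2 = 1 + (n-1) d$ for $k = 0$, and of $n d^2 = 1$ for $k \<noteq> 0$.\<close>

definition slopes :: "nat \<Rightarrow> complex set" where
  "slopes k = (if k = 0 then {1, - (1 / of_nat n)}
     else {1 / of_real (sqrt (real n)), - (1 / of_real (sqrt (real n)))})"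

lemma inverse_sqrt_n:
  "of_nat n * (1 / of_real (sqrt (real n)))\<^sup>2 = (1 :: complex)"
proof -
  have "(of_real (sqrt (real n)))\<^sup>2 = (of_nat n :: complex)"
    unfolding of_real_power[symmetric] by simp
  then show ?thesis using n_pos by (simp add: power_divide)
qed

lemma slopes_quadratic:
  assumes "d \<in> slopes k"
  shows "of_nat n * d\<^sup>2 = 1 + (if k = 0 then of_nat (n - 1) * d else 0)"
proof (cases "k = 0")
  case True
  then show ?thesis
    using assms n_pos by (auto simp: slopes_def power2_eq_square field_simps of_nat_diff)
next
  case False
  then have "d\<^sup>2 = (1 / of_real (sqrt (real n)))\<^sup>2" using assms by (auto simp: slopes_def)
  with False show ?thesis using inverse_sqrt_n by simp
qed

text \<open>The two roots of either quadratic equation have product $-1/n$.\<close>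

lemma slopes_conjugate:
  assumes "d \<in> slopes k" "d' \<in> slopes k" "d \<noteq> d'"
  shows "1 + of_nat n * d * d' = 0"
proof (cases "k = 0")
  case True
  then show ?thesis using assms n_pos by (auto simp: slopes_def)
next
  case False
  then have "d * d' = - ((1 / of_real (sqrt (real n)))\<^sup>2)"
    using assms by (auto simp: slopes_def power2_eq_square)
  then show ?thesis using inverse_sqrt_n by (simp add: mult.assoc)
qed

text \<open>The coefficient that turns $\frac{1}{(n+1)m} M(\theta_k, d\,\theta_k)$ into an idempotent: its square is
  $\frac{1}{n+1}(1 + n d^2)$ times itself.\<close>

definition scale :: "complex \<Rightarrow> complex" where
  "scale d = of_nat (n + 1) / (1 + of_nat n * d\<^sup>2)"

lemma scale_simps:
  "scale 1 = 1" "scale (- (1 / of_nat n)) = of_nat n"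
  "scale (1 / of_real (sqrt (real n))) = of_nat (n + 1) / 2"
  "scale (- (1 / of_real (sqrt (real n)))) = of_nat (n + 1) / 2"
proof -
  have *: "1 + of_nat n \<noteq> (0 :: complex)" by (metis of_nat_Suc of_nat_neq_0)
  show "scale 1 = 1" "scale (- (1 / of_nat n)) = of_nat n"
    using n_pos * by (simp_all add: scale_def power2_eq_square field_simps)
  show "scale (1 / of_real (sqrt (real n))) = of_nat (n + 1) / 2"
    "scale (- (1 / of_real (sqrt (real n)))) = of_nat (n + 1) / 2"
    using inverse_sqrt_n unfolding scale_def power2_minus by simp_all
qed

lemma one_neq_inverse: "1 \<noteq> - (1 / of_nat n :: complex)"
proof
  assume "1 = - (1 / of_nat n :: complex)"
  then have "of_nat (n + 1) = (0 :: complex)" using n_pos by (simp add: field_simps)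
  then show False by (metis Suc_eq_plus1 of_nat_neq_0)
qed

text \<open>These two sums make the idempotents add up to a matrix with zero entries outside the diagonal
  blocks and $\frac1m \sum_k \theta_k$ inside them.\<close>

lemma sum_scale: "(\<Sum>d\<in>slopes k. scale d) = of_nat (n + 1)" "(\<Sum>d\<in>slopes k. scale d * d) = 0"
proof -
  have ne': "1 / of_real (sqrt (real n)) \<noteq> - (1 / of_real (sqrt (real n)) :: complex)"
    using n_pos by (simp add: field_simps)
  show "(\<Sum>d\<in>slopes k. scale d) = of_nat (n + 1)" "(\<Sum>d\<in>slopes k. scale d * d) = 0"
    using n_pos one_neq_inverse ne' by (auto simp: slopes_def scale_simps)
qed

definition eigen_labels :: "(nat \<times> complex) set" where
  "eigen_labels = Sigma {..h} slopes"

definition idem :: "nat \<times> complex \<Rightarrow> complex mat" where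
  "idem = (\<lambda>(k, d). (scale d / of_nat v) \<cdot>\<^sub>m algebra_mat (theta m (int k)) (\<lambda>t. d * theta m (int k) t))"

lemma even_periodic_theta_scaled: "even_periodic m (\<lambda>t. d * theta m k t)"
proof -
  interpret even_periodic m "theta m k" by (rule even_periodic_theta[OF m_pos])
  show ?thesis by unfold_locales (simp_all add: even periodic m_pos)
qed

lemma idem_eq: "idem (k, d) = algebra_mat (\<lambda>t. scale d / of_nat v * theta m (int k) t)
   (\<lambda>t. scale d / of_nat v * d * theta m (int k) t)"
  unfolding idem_def by (intro eq_matI) (auto simp: algebra_mat_index)

lemma v_nonzero: "(of_nat v :: complex) \<noteq> 0"
  using m_pos by (simp only: of_nat_eq_0_iff) simp

lemma algebra_mat_mult_idem:
  assumes "even_periodic m f" "even_periodic m g" "k \<le> h" "d \<in> slopes k"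
  shows "algebra_mat f g * idem (k, d) = (fourier m f (int k) + of_nat n * d * fourier m g (int k)) \<cdot>\<^sub>m idem (k, d)"
proof -
  have "\<not> m dvd k" if "k > 0" using that assms(3) m_pos by (auto dest!: dvd_imp_le)
  then have "int m dvd int k \<longleftrightarrow> k = 0" by (cases "k = 0") auto
  then have "of_nat n * d\<^sup>2 = 1 + (if int m dvd int k then of_nat (n - 1) * d else 0)"
    using slopes_quadratic[OF assms(4)] by simp
  note algebra_mat = algebra_mat_mult_theta[OF assms(1,2) this]
  have "algebra_mat f g * idem (k, d) = (scale d / of_nat v) \<cdot>\<^sub>m
      (algebra_mat f g * algebra_mat (theta m (int k)) (\<lambda>t. d * theta m (int k) t))"
    unfolding idem_def prod.case by (rule mult_smult_distrib[OF algebra_mat_carrier(1) algebra_mat_carrier(1)])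
  then show ?thesis
    unfolding algebra_mat by (auto simp: idem_def intro!: eq_matI)
qed

text \<open>For $k \<noteq> l$ orthogonality comes from orthogonality of the characters; for $k = l$ the scalar
  is a multiple of $1 + n d d'$, which vanishes for the two different roots.\<close>

lemma idempotent_basis_idem: "idempotent_basis v adj_mats eigen_labels idem"
proof
  fix p assume "p \<in> eigen_labels"
  then obtain k d where p: "p = (k, d)" "k \<le> h" "d \<in> slopes k" by (auto simp: eigen_labels_def)
  show "idem p \<in> adjacency_algebra v adj_mats"
    unfolding p idem_eq by (intro algebra_mat_in_algebra even_periodic_theta_scaled)
  show "idem p \<noteq> 0\<^sub>m v v"
  proof
    assume 0: "idem p = 0\<^sub>m v v"
    have s: "scale d \<noteq> 0"
      using p(3) n_pos scale_simps by (auto simp: slopes_def split: if_splits simp del: of_nat_Suc)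
    have "0 < v" using m_pos by simp
    then have "scale d / of_nat v * theta m (int k) 0 = 0"
      using arg_cong[OF 0, of "\<lambda>X. X $$ (0, 0)"] by (simp add: p idem_eq algebra_mat_index del: mult_Suc)
    then show False using s v_nonzero by (simp add: theta_def split: if_splits)
  qed
  fix X assume "X \<in> adjacency_algebra v adj_mats"
  then obtain f g where "even_periodic m f" "even_periodic m g" "X = algebra_mat f g"
    by (rule adjacency_algebraE)
  then show "\<exists>c. X * idem p = c \<cdot>\<^sub>m idem p" using algebra_mat_mult_idem p by blast
next
  fix p q assume "p \<in> eigen_labels" "q \<in> eigen_labels" and ne: "p \<noteq> q"
  then obtain k d l d' where p: "p = (k, d)" "k \<le> h" "d \<in> slopes k" and q: "q = (l, d')" "l \<le> h" "d' \<in> slopes l"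
    by (auto simp: eigen_labels_def)
  have fourier: "fourier m (\<lambda>t. a * theta m (int k) t) (int l) = a * (if k = l then of_nat m else 0)" for a
    unfolding fourier_theta[OF m_pos p(2) q(2), symmetric] by (simp add: fourier_def sum_distrib_left mult.assoc)
  then have "idem p * idem q = (scale d / of_nat v * (if k = l then of_nat m * (1 + of_nat n * d * d') else 0)) \<cdot>\<^sub>m idem q"
    unfolding p q idem_eq[of k d]
    unfolding algebra_mat_mult_idem[OF even_periodic_theta_scaled even_periodic_theta_scaled q(2,3)]
    unfolding fourier by (simp add: algebra_simps add_divide_distrib)
  also have "\<dots> = 0 \<cdot>\<^sub>m idem q" using slopes_conjugate p q ne by auto
  also have "\<dots> = 0\<^sub>m v v" by (auto simp: q idem_def)
  finally show "idem p * idem q = 0\<^sub>m v v" .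
next
  fix a b assume ab: "a < v" "b < v"
  let ?t = "if a div m = b div m then int (b mod m) - int (a mod m)
    else int (a mod m) + int (b mod m) + e (a div m) (b div m) + 1"
  let ?c = "\<lambda>d. if a div m = b div m then scale d else scale d * d"
  have fin: "finite (slopes k)" for k by (simp add: slopes_def)
  have entry: "idem (k, d) $$ (a, b) = ?c d * (theta m (int k) ?t / of_nat v)" for k d
    using ab by (simp add: idem_eq algebra_mat_index)
  have "(\<Sum>p\<in>eigen_labels. idem p $$ (a, b)) = (\<Sum>k\<le>h. \<Sum>d\<in>slopes k. ?c d * (theta m (int k) ?t / of_nat v))"
    unfolding eigen_labels_def using fin by (subst sum.Sigma) (auto intro!: sum.cong simp: entry)
  also have "\<dots> = (\<Sum>k\<le>h. (\<Sum>d\<in>slopes k. ?c d) * (theta m (int k) ?t / of_nat v))"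
    by (simp only: sum_distrib_right)
  also have "\<dots> = (\<Sum>k\<le>h. (if a div m = b div m then of_nat (n + 1) else 0) * (theta m (int k) ?t / of_nat v))"
    using sum_scale by (intro sum.cong refl arg_cong2[where f = "(*)"]) auto
  also have "\<dots> = (if a div m = b div m then of_nat (n + 1) else 0) * (if int m dvd ?t then of_nat m else 0) / of_nat v"
    by (simp only: sum_distrib_left[symmetric] sum_divide_distrib[symmetric] sum_theta_index[OF m_pos]) simp
  also have "\<dots> = (if a div m = b div m \<and> int m dvd int (b mod m) - int (a mod m) then 1 else 0)"
    using v_nonzero by (simp add: algebra_simps)
  also have "int m dvd int (b mod m) - int (a mod m) \<longleftrightarrow> a mod m = b mod m"
    by (metis cong_iff_dvd_diff cong_int_iff cong_def mod_mod_trivial)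
  also have "(if a div m = b div m \<and> a mod m = b mod m then 1 else 0 :: complex) = 1\<^sub>m v $$ (a, b)"
    using ab by (metis div_mult_mod_eq index_one_mat(1))
  finally show "(\<Sum>p\<in>eigen_labels. idem p $$ (a, b)) = 1\<^sub>m v $$ (a, b)" .
next
  fix X assume "X \<in> adjacency_algebra v adj_mats"
  then show "transpose_mat X = X" by (rule adjacency_algebraE) (simp add: algebra_mat_symmetric)
qed

end

section \<open>The scheme and its second eigenmatrix\<close>

context cyclic_weights
begin

lemma rho_symmetric:
  assumes "a < v" "b < v"
  shows "rho a b = rho b a"
  using e_sym[OF block_index block_index, OF assms] rep_minus[of m "int (b mod m) - int (a mod m)"]
  by (simp add: rho_def algebra_simps)

lemma rho_eq_0_iff: "rho a b = 0 \<longleftrightarrow> a = b"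
proof
  assume "rho a b = 0"
  then have blk: "a div m = b div m" and "rep m (int (b mod m) - int (a mod m)) = 0"
    by (auto simp: rho_def split: if_splits)
  then have "[int (b mod m) - int (a mod m) = 0] (mod int m)"
    using rep_eq_iff[OF m_pos, of 0] by simp
  then have "b mod m = a mod m"
    by (metis cong_diff_iff_cong_0 cong_int_iff cong_def mod_mod_trivial)
  with blk show "a = b" by (metis div_mult_mod_eq)
qed (simp add: rho_def rep_def)

text \<open>The pairs starting at vertex $0$ and ending in the first two blocks already meet every class; a
  second block exists because $n > 0$.\<close>

lemma rho_surjective:
  assumes "l < 2 * (h + 1)"
  shows "\<exists>a<v. \<exists>b<v. rho a b = l"
proof (cases "l \<le> h")
  case True
  moreover have "h < m" using m_pos by simp
  ultimately have lm: "l < m" by simp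
  then have "rho 0 l = l" using rep_of_small[OF m_pos True] by (simp add: rho_def)
  moreover have "0 < v" "l < v" using lm by auto
  ultimately show ?thesis by blast
next
  case False
  define k where "k = l - (h + 1)"
  have k: "k \<le> h" "l = h + 1 + k" using False assms by (auto simp: k_def)
  define z where "z = nat ((int k - e 0 1 - 1) mod int m)"
  have z: "z < m" "int z = (int k - e 0 1 - 1) mod int m"
    using m_pos by (auto simp: z_def nat_less_iff)
  have "[int z + (e 0 1 + 1) = int k - e 0 1 - 1 + (e 0 1 + 1)] (mod int m)"
    by (rule cong_add) (simp_all add: z(2))
  then have "rep m (int z + e 0 1 + 1) = k"
    using rep_cong[of "int z + e 0 1 + 1" "int k" m] rep_of_small[OF m_pos k(1)] by (simp add: algebra_simps)
  then have "rho 0 (m + z) = l" using z(1) by (simp add: rho_def k(2))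
  moreover have "m + z < v"
  proof -
    have "m + z < 2 * m" using z(1) by simp
    also have "2 * m \<le> v" using n_pos by (intro mult_right_mono) auto
    finally show ?thesis .
  qed
  moreover have "0 < v" using m_pos by simp
  ultimately show ?thesis by blast
qed

lemma symmetric_scheme: "symmetric_association_scheme v adj_mats"
  unfolding adj_mats_def
proof (rule symmetric_association_scheme_relation_mats)
  show "0 < v" using m_pos by simp
  show "A * B \<in> adjacency_algebra v (relation_mats v (2 * (h + 1)) rho)"
    if "A \<in> adjacency_algebra v (relation_mats v (2 * (h + 1)) rho)"
      "B \<in> adjacency_algebra v (relation_mats v (2 * (h + 1)) rho)" for A B
    using idempotent_basis.product_in_algebra[OF idempotent_basis_idem, of A B] that
    by (simp only: adj_mats_def)
qed (rule rho_less, rule rho_symmetric, assumption+, rule rho_eq_0_iff, rule rho_surjective, assumption)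

text \<open>The labels in the order of the columns of $Q$.  The list \<open>ks\<close> is a parameter because $k = m/2$
  comes first when $m$ is even.\<close>

definition labels :: "nat list \<Rightarrow> (nat \<times> complex) list" where
  "labels ks = [(0, 1), (0, - (1 / of_nat n))] @
     concat (map (\<lambda>k. [(k, 1 / of_real (sqrt (real n))), (k, - (1 / of_real (sqrt (real n))))]) ks)"

definition qcol :: "nat \<times> complex \<Rightarrow> complex vec" where
  "qcol = (\<lambda>(k, d). vec (2 * (h + 1)) (\<lambda>l. scale d *
     (if l \<le> h then theta m (int k) (int l) else d * theta m (int k) (int (l - (h + 1))))))"

lemma labels_properties:
  assumes "distinct ks" "set ks = {1..h}"
  shows "length (labels ks) = 2 * (h + 1)" "distinct (labels ks)" "set (labels ks) = eigen_labels"
proof -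
  have "length (concat (map (\<lambda>k. [(k, 1 / of_real (sqrt (real n))),
      (k, - (1 / of_real (sqrt (real n))) :: complex)]) ks)) = 2 * length ks" for ks :: "nat list"
    by (induction ks) auto
  moreover have "length ks = h" using assms distinct_card[of ks] by simp
  ultimately show "length (labels ks) = 2 * (h + 1)" by (simp add: labels_def)
  have "distinct (concat (map (\<lambda>k. [(k, 1 / of_real (sqrt (real n))),
      (k, - (1 / of_real (sqrt (real n))) :: complex)]) ks))"
    using assms(1) n_pos by (induction ks) (auto simp: field_simps)
  then show "distinct (labels ks)" using assms(2) one_neq_inverse by (auto simp: labels_def)
  show "set (labels ks) = eigen_labels"
  proof (rule Set.set_eqI)
    fix p :: "nat \<times> complex"
    obtain k d where p: "p = (k, d)" by (cases p)
    have "p \<in> set (labels ks) \<longleftrightarrow> k = 0 \<and> d \<in> {1, - (1 / of_nat n)} \<or>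
        k \<in> set ks \<and> d \<in> {1 / of_real (sqrt (real n)), - (1 / of_real (sqrt (real n)))}"
      by (auto simp: labels_def p)
    then show "p \<in> set (labels ks) \<longleftrightarrow> p \<in> eigen_labels"
      unfolding assms(2) by (simp add: eigen_labels_def slopes_def p)
  qed
qed

lemma idem_eq_qcol:
  "idem p = (1 / of_nat v) \<cdot>\<^sub>m lin_comb v (\<lambda>l. qcol p $ l) adj_mats"
proof (cases p)
  case (Pair k d)
  show ?thesis
    unfolding Pair idem_def prod.case
      algebra_mat_eq_lin_comb[OF even_periodic_theta[OF m_pos] even_periodic_theta_scaled] lin_comb_adj_mats
    using rho_less by (intro eq_matI) (auto simp: qcol_def)
qed

lemma second_eigenmatrix_qcol:
  assumes "distinct ks" "set ks = {1..h}"
  shows "second_eigenmatrix v adj_mats (mat_of_cols (2 * (h + 1)) (map qcol (labels ks)))"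
proof -
  note L = labels_properties[OF assms]
  interpret idempotent_basis v adj_mats eigen_labels idem by (rule idempotent_basis_idem)
  have fin: "finite eigen_labels" using L(3) by (metis List.finite_set)
  have len: "length adj_mats = 2 * (h + 1)" by (simp add: adj_mats_def relation_mats_def)
  let ?Es = "map idem (labels ks)"
  have "distinct ?Es" using L inj[OF fin] by (simp add: distinct_map)
  moreover have "set ?Es = primitive_idempotents v adj_mats"
    using L(3) primitive[OF _ fin] primitive_only[OF _ fin] by auto
  moreover have "?Es ! k = (1 / of_nat v) \<cdot>\<^sub>m lin_comb v
      (\<lambda>l. mat_of_cols (2 * (h + 1)) (map qcol (labels ks)) $$ (l, k)) adj_mats"
    if k: "k < length adj_mats" for k
  proof -
    have "lin_comb v (\<lambda>l. mat_of_cols (2 * (h + 1)) (map qcol (labels ks)) $$ (l, k)) adj_mats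
        = lin_comb v (\<lambda>l. qcol (labels ks ! k) $ l) adj_mats"
      unfolding lin_comb_adj_mats using rho_less L(1) k len
      by (intro eq_matI) (auto simp: mat_of_cols_index)
    then show ?thesis using k len L(1) by (simp add: idem_eq_qcol)
  qed
  ultimately show ?thesis
    unfolding second_eigenmatrix_def using L(1) len
    by (intro conjI exI[of _ ?Es]) auto
qed

end

section \<open>Balanced generalized weighing matrices\<close>

lemma U_mat_pow_eq_iff:
  assumes "m > 0"
  shows "U_mat m ^\<^sub>m p = U_mat m ^\<^sub>m q \<longleftrightarrow> [p = q] (mod m)"
proof
  assume "U_mat m ^\<^sub>m p = U_mat m ^\<^sub>m q"
  then have "(U_mat m ^\<^sub>m p) $$ (0, p mod m) = (U_mat m ^\<^sub>m q) $$ (0, p mod m)" by simp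
  then show "[p = q] (mod m)" using assms by (simp add: U_mat_pow cong_def split: if_splits)
next
  assume "[p = q] (mod m)"
  then have "(i + p) mod m = (i + q) mod m" for i
    unfolding cong_def by (metis mod_add_right_eq)
  then show "U_mat m ^\<^sub>m p = U_mat m ^\<^sub>m q" by (simp add: U_mat_pow)
qed

lemma U_mat_pow_add: "U_mat m ^\<^sub>m (a + b) = U_mat m ^\<^sub>m a * U_mat m ^\<^sub>m b"
  by (induction b) (auto simp: assoc_mult_mat[of _ m m _ m _ m] pow_carrier_mat U_mat_def)

lemma cong_nat_sum_iff:
  fixes x z q :: nat
  shows "[int x + int z + int q + 1 = 0] (mod int m) \<longleftrightarrow> m dvd x + z + q + 1"
proof -
  have "int x + int z + int q + 1 = int (x + z + q + 1)" by simp
  then show ?thesis unfolding cong_0_iff by (simp only: int_dvd_int_iff)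
qed

text \<open>The back diagonal turns the circulant condition on $z - x$ into one on $x + z$, which is symmetric
  in $x$ and $z$.  Since $0 < ((x + q) \bmod m) + z + 1 < 2m$, divisibility by $m$ is equality
  with $m$.\<close>

lemma U_mat_pow_R_mat_index:
  assumes x: "x < m" and z: "z < m"
  shows "(U_mat m ^\<^sub>m q * R_mat m) $$ (x, z) = of_bool (m dvd x + z + q + 1)"
proof -
  have "(U_mat m ^\<^sub>m q * R_mat m) $$ (x, z)
      = (\<Sum>y<m. (if y = (x + q) mod m then 1 else 0) * (if y + z + 1 = m then 1 else 0))"
    using x z by (simp add: U_mat_pow R_mat_def scalar_prod_def lessThan_atLeast0)
  also have "\<dots> = (\<Sum>y<m. if y = (x + q) mod m then of_bool ((x + q) mod m + z + 1 = m) else 0)"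
    by (intro sum.cong) auto
  also have "\<dots> = of_bool ((x + q) mod m + z + 1 = m)" using x by simp
  also have "(x + q) mod m + z + 1 = m \<longleftrightarrow> m dvd (x + q) mod m + z + 1"
  proof
    assume "m dvd (x + q) mod m + z + 1"
    then obtain r where r: "(x + q) mod m + z + 1 = m * r" by (elim dvdE)
    have "(x + q) mod m < m" using x by simp
    then have "m * r < m * 2" using z r by linarith
    then have "r < 2" using x by simp
    moreover have "r \<noteq> 0" using r by (cases r) auto
    ultimately have "r = 1" by simp
    with r show "(x + q) mod m + z + 1 = m" by simp
  qed simp
  also have "\<dots> \<longleftrightarrow> m dvd x + z + q + 1"
    unfolding dvd_eq_mod_eq_0 by (metis (no_types, lifting) add.assoc add.commute mod_add_left_eq)
  finally show ?thesis .
qed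

lemma not_dvd_double:
  fixes l m :: nat
  assumes "0 < l" "2 * l < m"
  shows "\<not> int m dvd 2 * int l"
  using zdvd_not_zless[of "2 * int l" "int m"] assms by simp

locale bgw_weights = cyclic_weights +
  fixes W :: "complex mat option mat"
  assumes W_entry: "i \<le> n \<Longrightarrow> j \<le> n \<Longrightarrow> i \<noteq> j \<Longrightarrow>
    \<exists>p. e i j = int p \<and> W $$ (i, j) = Some (U_mat m ^\<^sub>m p)"
begin

lemma A0_eq: "A0 n m l = mat v v (\<lambda>(a, b).
    of_bool (a div m = b div m \<and> [int (b mod m) - int (a mod m) = int l] (mod int m)))"
proof (rule eq_matI)
  fix a b assume "a < dim_row (mat v v (\<lambda>(a, b).
    of_bool (a div m = b div m \<and> [int (b mod m) - int (a mod m) = int l] (mod int m))))"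
    "b < dim_col (mat v v (\<lambda>(a, b).
    of_bool (a div m = b div m \<and> [int (b mod m) - int (a mod m) = int l] (mod int m))))"
  then have ab: "a < v" "b < v" by auto
  have "b mod m = (a mod m + l) mod m \<longleftrightarrow> [int (b mod m) = int (a mod m + l)] (mod int m)"
    unfolding cong_int_iff by (simp add: cong_def)
  also have "\<dots> \<longleftrightarrow> [int (b mod m) - int (a mod m) = int l] (mod int m)"
    unfolding cong_iff_dvd_diff by (simp add: algebra_simps)
  finally show "A0 n m l $$ (a, b) = mat v v (\<lambda>(a, b).
    of_bool (a div m = b div m \<and> [int (b mod m) - int (a mod m) = int l] (mod int m))) $$ (a, b)"
    using ab m_pos block_index[OF ab(1)] block_index[OF ab(2)]
    by (auto simp: A0_def kron_def U_mat_pow)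
qed (auto simp: A0_def kron_def U_mat_pow)

lemma A1_eq: "A1 n m W l = mat v v (\<lambda>(a, b). of_bool (a div m \<noteq> b div m \<and>
    [int (a mod m) + int (b mod m) + e (a div m) (b div m) + 1 = - int l] (mod int m)))"
    (is "_ = ?R")
proof (rule eq_matI)
  fix a b assume "a < dim_row ?R" "b < dim_col ?R"
  then have ab: "a < v" "b < v" by auto
  note blk = block_index[OF ab(1)] block_index[OF ab(2)]
  have xz: "a mod m < m" "b mod m < m" using m_pos by auto
  show "A1 n m W l $$ (a, b) = ?R $$ (a, b)"
  proof (cases "a div m = b div m")
    case True
    then show ?thesis
      using ab xz blk by (simp add: A1_def N_mat_def block_mat_def kron_def all_ones_def)
  next
    case False
    then obtain p where p: "e (a div m) (b div m) = int p"
      "W $$ (a div m, b div m) = Some (U_mat m ^\<^sub>m p)"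
      using W_entry blk by blast
    have "A1 n m W l $$ (a, b) = (U_mat m ^\<^sub>m (p + l) * R_mat m) $$ (a mod m, b mod m)"
      using ab xz blk False
      by (simp add: A1_def N_mat_def block_mat_def kron_def all_ones_def p entry_mat_def U_mat_pow_add)
    also have "\<dots> = of_bool (m dvd a mod m + b mod m + (p + l) + 1)"
      by (rule U_mat_pow_R_mat_index[OF xz])
    also have "m dvd a mod m + b mod m + (p + l) + 1 \<longleftrightarrow>
        [int (a mod m) + int (b mod m) + int p + 1 = - int l] (mod int m)"
      unfolding cong_nat_sum_iff[symmetric] cong_iff_dvd_diff by (simp add: algebra_simps)
    finally show ?thesis using False ab by (simp add: p)
  qed
qed (auto simp: A1_def N_mat_def block_mat_def kron_def all_ones_def)

lemma cong_m_minus: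
  assumes "l \<le> m"
  shows "[t = int (m - l)] (mod int m) \<longleftrightarrow> [t = - int l] (mod int m)"
    and "[t = - int (m - l)] (mod int m) \<longleftrightarrow> [t = int l] (mod int m)"
proof -
  have "[int (m - l) = - int l] (mod int m)" "[- int (m - l) = int l] (mod int m)"
    using assms by (simp_all add: cong_iff_dvd_diff of_nat_diff)
  then show "[t = int (m - l)] (mod int m) \<longleftrightarrow> [t = - int l] (mod int m)"
    "[t = - int (m - l)] (mod int m) \<longleftrightarrow> [t = int l] (mod int m)"
    by (meson cong_sym cong_trans)+
qed

definition rel_mat :: "nat \<Rightarrow> complex mat" where
  "rel_mat l = mat v v (\<lambda>(a, b). of_bool (rho a b = l))"

lemma adj_mats_eq: "adj_mats = map rel_mat [0..<2 * (h + 1)]"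
  by (simp add: adj_mats_def relation_mats_def rel_mat_def[abs_def] del: upt_Suc)

lemma rho_eq_iff:
  assumes "l \<le> h"
  shows "rho a b = l \<longleftrightarrow> a div m = b div m \<and>
      ([int (b mod m) - int (a mod m) = int l] (mod int m) \<or> [int (b mod m) - int (a mod m) = - int l] (mod int m))"
    and "rho a b = h + 1 + l \<longleftrightarrow> a div m \<noteq> b div m \<and>
      ([int (a mod m) + int (b mod m) + e (a div m) (b div m) + 1 = int l] (mod int m) \<or>
       [int (a mod m) + int (b mod m) + e (a div m) (b div m) + 1 = - int l] (mod int m))"
  unfolding rep_eq_iff[OF m_pos assms, symmetric]
  using rep_le[OF m_pos, of "int (b mod m) - int (a mod m)"] assms by (auto simp: rho_def)

text \<open>When $2l \equiv 0$ the classes of $l$ and $-l$ coincide.\<close>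

lemma rel_mat_self_paired:
  assumes "l \<le> h" "int m dvd 2 * int l"
  shows "rel_mat l = A0 n m l" "rel_mat (h + 1 + l) = A1 n m W l"
proof -
  have "[int l = - int l] (mod int m)" using assms(2) by (simp add: cong_iff_dvd_diff)
  then have "[t = int l] (mod int m) \<longleftrightarrow> [t = - int l] (mod int m)" for t
    by (meson cong_sym cong_trans)
  then show "rel_mat l = A0 n m l" "rel_mat (h + 1 + l) = A1 n m W l"
    unfolding rel_mat_def A0_eq A1_eq rho_eq_iff[OF assms(1)] by simp_all
qed

lemma rel_mat_pair:
  assumes "l \<le> h" "\<not> int m dvd 2 * int l"
  shows "rel_mat l = A0 n m l + A0 n m (m - l)"
    "rel_mat (h + 1 + l) = A1 n m W l + A1 n m W (m - l)"
proof -
  have "l \<le> m" using assms(1) by simp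
  note minus = cong_m_minus[OF this]
  have "\<not> [int l = - int l] (mod int m)" using assms(2) by (simp add: cong_iff_dvd_diff)
  then have excl: "\<not> ([t = int l] (mod int m) \<and> [t = - int l] (mod int m))" for t
    by (meson cong_sym cong_trans)
  show "rel_mat l = A0 n m l + A0 n m (m - l)"
    unfolding rel_mat_def A0_eq rho_eq_iff[OF assms(1)] minus using excl
    by (intro eq_matI) auto
  show "rel_mat (h + 1 + l) = A1 n m W l + A1 n m W (m - l)"
    unfolding rel_mat_def A1_eq rho_eq_iff[OF assms(1)] minus using excl
    by (intro eq_matI) auto
qed

lemma rel_mat_0: "rel_mat 0 = A0 n m 0" "rel_mat (h + 1) = A1 n m W 0"
  using rel_mat_self_paired[of 0] by simp_all

lemma upt_two_blocks: "[0..<2 * (h + 1)] = [0..<h + 1] @ map (\<lambda>l. h + 1 + l) [0..<h + 1]"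
  by (rule nth_equalityI) (auto simp: nth_append simp del: upt_Suc)

lemma scheme_even_eq:
  assumes "even m"
  shows "scheme_even n m W = adj_mats"
proof -
  have m: "m = 2 * h" and h: "h > 0" using assms m_pos by (auto elim!: evenE)
  have pairs: "map (\<lambda>i. A0 n m i + A0 n m (m - i)) [1..<h] = map rel_mat [1..<h]"
    "map (\<lambda>i. A1 n m W i + A1 n m W (m - i)) [1..<h] = map (\<lambda>l. rel_mat (h + 1 + l)) [1..<h]"
    using m by (intro map_cong refl rel_mat_pair[symmetric] not_dvd_double; auto)+
  have "int m = 2 * int h" using m by linarith
  then have "int m dvd 2 * int h" by simp
  note mid = rel_mat_self_paired[OF le_refl this, symmetric]
  have half: "[0..<h + 1] = [0] @ [1..<h] @ [h]" using h by (simp add: upt_conv_Cons)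
  show ?thesis
    unfolding adj_mats_eq upt_two_blocks half scheme_even_def pairs mid
    by (simp add: rel_mat_0[simplified] comp_def del: upt_Suc)
qed

lemma scheme_odd_eq:
  assumes "odd m"
  shows "scheme_odd n m W = adj_mats"
proof -
  have m: "m = 2 * h + 1" and h: "(m - 1) div 2 = h" using assms by (auto elim!: oddE)
  have pairs: "map (\<lambda>i. A0 n m i + A0 n m (m - i)) [1..<h + 1] = map rel_mat [1..<h + 1]"
    "map (\<lambda>i. A1 n m W i + A1 n m W (m - i)) [1..<h + 1] = map (\<lambda>l. rel_mat (h + 1 + l)) [1..<h + 1]"
    using m by (intro map_cong refl rel_mat_pair[symmetric] not_dvd_double; auto)+
  have half: "[0..<h + 1] = [0] @ [1..<h + 1]" by (simp add: upt_conv_Cons del: upt_Suc)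
  show ?thesis
    unfolding adj_mats_eq upt_two_blocks half scheme_odd_def h pairs
    by (simp add: rel_mat_0[simplified] comp_def del: upt_Suc)
qed

end

context cyclic_weights
begin

lemma chi_eq: "chi m k = vec (h + 1) (\<lambda>t. add_char m (int k) (int t))"
proof -
  have "exp (2 * of_real pi * \<i> / of_nat m) = add_char m 1 1"
    by (simp add: add_char_def cis_conv_exp mult.commute)
  then have "exp (2 * of_real pi * \<i> / of_nat m) ^ (t * k) = add_char m (int k) (int t)" for t
    using add_char_nat[of m 1 "t * k"] by (simp add: add_char_def mult.commute)
  then show ?thesis by (simp add: chi_def)
qed

definition theta_vec :: "nat \<Rightarrow> complex vec" where
  "theta_vec k = vec (h + 1) (\<lambda>t. theta m (int k) (int t))"

lemma chi_self_paired: "int m dvd 2 * int k \<Longrightarrow> chi m k = theta_vec k"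
  by (simp add: chi_eq theta_vec_def theta_def)

lemma chi_pair:
  assumes "k \<le> m" "\<not> int m dvd 2 * int k"
  shows "chi m k + chi m (m - k) = theta_vec k"
proof -
  have "add_char m (int (m - k)) t = add_char m (- int k) t" for t
    using add_char_periodic[OF m_pos, of t "- int k"] assms(1) by (simp add: add_char_commute[of m _ t] of_nat_diff)
  then show ?thesis using assms(2) by (auto simp: chi_eq theta_vec_def theta_def)
qed

lemma qcol_eq: "qcol (k, d) = scale d \<cdot>\<^sub>v theta_vec k @\<^sub>v (scale d * d) \<cdot>\<^sub>v theta_vec k"
  by (intro eq_vecI) (auto simp: qcol_def theta_vec_def)

lemma Q_pair_eq:
  "Q_pair n (theta_vec k) =
     map qcol [(k, 1 / of_real (sqrt (real n))), (k, - (1 / of_real (sqrt (real n))))]"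
  by (simp add: Q_pair_def qcol_eq scale_simps)

lemma trivial_columns:
  "[chi m 0 @\<^sub>v chi m 0, of_nat n \<cdot>\<^sub>v chi m 0 @\<^sub>v - chi m 0] = map qcol [(0, 1), (0, - (1 / of_nat n))]"
proof -
  have "chi m 0 = theta_vec 0" by (rule chi_self_paired) simp
  moreover have "- theta_vec 0 = (- 1) \<cdot>\<^sub>v theta_vec 0" by (intro eq_vecI) auto
  ultimately show ?thesis using n_pos by (simp add: qcol_eq scale_simps)
qed

lemma map_qcol_labels:
  "map qcol (labels ks) = map qcol [(0, 1), (0, - (1 / of_nat n))] @ concat (map (\<lambda>k. Q_pair n (theta_vec k)) ks)"
  by (simp add: labels_def Q_pair_eq map_concat comp_def)

lemma Q_even_eq:
  assumes "even m"
  shows "Q_even n m = mat_of_cols (2 * (h + 1)) (map qcol (labels (h # [1..<h])))"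
proof -
  have m: "m = 2 * h" using assms by simp
  have "int m = 2 * int h" using m by linarith
  then have "chi m h = theta_vec h" by (intro chi_self_paired) simp
  moreover have "map (\<lambda>k. Q_pair n (chi m k + chi m (m - k))) [1..<h] = map (\<lambda>k. Q_pair n (theta_vec k)) [1..<h]"
  proof (rule map_cong[OF refl])
    fix k assume "k \<in> set [1..<h]"
    then have "0 < k" "2 * k < m" using m by auto
    then show "Q_pair n (chi m k + chi m (m - k)) = Q_pair n (theta_vec k)"
      by (simp add: chi_pair not_dvd_double)
  qed
  ultimately show ?thesis
    unfolding Q_even_def trivial_columns map_qcol_labels by (simp only: list.map concat.simps)
qed

lemma Q_odd_eq:
  assumes "odd m"
  shows "Q_odd n m = mat_of_cols (2 * (h + 1)) (map qcol (labels [1..<h + 1]))"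
proof -
  have m: "m = 2 * h + 1" and h: "(m - 1) div 2 = h" using assms by (auto elim!: oddE)
  have "map (\<lambda>k. Q_pair n (chi m k + chi m (m - k))) [1..<h + 1] = map (\<lambda>k. Q_pair n (theta_vec k)) [1..<h + 1]"
  proof (rule map_cong[OF refl])
    fix k assume "k \<in> set [1..<h + 1]"
    then have "0 < k" "2 * k < m" using m by auto
    then show "Q_pair n (chi m k + chi m (m - k)) = Q_pair n (theta_vec k)"
      by (simp add: chi_pair not_dvd_double)
  qed
  then show ?thesis
    unfolding Q_odd_def trivial_columns map_qcol_labels h by (simp only:)
qed

end

text \<open>Row weight $n$ and a zero diagonal leave no room for a zero off the diagonal, so every such entry
  is a power of $U$, and $w_{ij} w_{hj}^{-1} = U^t$ becomes $e(i,j) - e(h,j) \equiv t$.\<close>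

lemma bgw_weights_of_BGW:
  fixes n m :: nat and W :: "complex mat option mat"
  assumes n: "n > 0" and m: "m > 0"
    and BGW: "BGW (cyclic_group_mat m) (n + 1) n (n - 1) W"
    and sym: "transpose_mat W = W"
    and diag: "\<forall>i < n + 1. W $$ (i, i) = None"
  obtains e where "bgw_weights n m e W"
proof -
  let ?G = "cyclic_group_mat m"
  interpret G: group ?G by (rule group_cyclic_group_mat(1)[OF m])
  have W: "W \<in> carrier_mat (n + 1) (n + 1)"
    and entries: "\<And>i j. i \<le> n \<Longrightarrow> j \<le> n \<Longrightarrow> W $$ (i, j) \<in> insert None (Some ` carrier ?G)"
    and rows: "\<And>i. i \<le> n \<Longrightarrow> card {j. j < n + 1 \<and> W $$ (i, j) \<noteq> None} = n"
    and bal: "\<And>i h g. i \<le> n \<Longrightarrow> h \<le> n \<Longrightarrow> i \<noteq> h \<Longrightarrow> g \<in> carrier ?G \<Longrightarrow>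
        real (card {j. j < n + 1 \<and> (\<exists>a b. W $$ (i, j) = Some a \<and> W $$ (h, j) = Some b \<and>
                                        a \<otimes>\<^bsub>?G\<^esub> inv\<^bsub>?G\<^esub> b = g)})
        = real (n - 1) / real (card (carrier ?G))"
    using BGW unfolding BGW_def by (auto simp: less_Suc_eq_le)
  define e where "e i j = int (SOME p. W $$ (i, j) = Some (U_mat m ^\<^sub>m p))" for i j
  have full: "{j. j < n + 1 \<and> W $$ (i, j) \<noteq> None} = {..n} - {i}" if "i \<le> n" for i
    using diag that rows[OF that] by (intro card_subset_eq) (auto simp: less_Suc_eq_le)
  have entry: "\<exists>p. e i j = int p \<and> W $$ (i, j) = Some (U_mat m ^\<^sub>m p)"
    if "i \<le> n" "j \<le> n" "i \<noteq> j" for i j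
  proof -
    have "W $$ (i, j) \<noteq> None" using full[OF that(1)] that by blast
    then have "\<exists>p. W $$ (i, j) = Some (U_mat m ^\<^sub>m p)"
      using entries[OF that(1,2)] by (auto simp: cyclic_group_mat_def)
    from someI_ex[OF this] show ?thesis unfolding e_def by blast
  qed
  have U_in: "U_mat m ^\<^sub>m p \<in> carrier ?G" for p by (simp add: cyclic_group_mat_def)
  have quotient: "U_mat m ^\<^sub>m p \<otimes>\<^bsub>?G\<^esub> inv\<^bsub>?G\<^esub> (U_mat m ^\<^sub>m q) = U_mat m ^\<^sub>m t
      \<longleftrightarrow> [int p - int q = int t] (mod int m)" for p q t
  proof -
    have "U_mat m ^\<^sub>m p \<otimes>\<^bsub>?G\<^esub> inv\<^bsub>?G\<^esub> (U_mat m ^\<^sub>m q) = U_mat m ^\<^sub>m t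
        \<longleftrightarrow> U_mat m ^\<^sub>m p = U_mat m ^\<^sub>m t \<otimes>\<^bsub>?G\<^esub> U_mat m ^\<^sub>m q"
      using G.inv_solve_right[of "U_mat m ^\<^sub>m t" "U_mat m ^\<^sub>m p" "U_mat m ^\<^sub>m q"] U_in by metis
    also have "\<dots> \<longleftrightarrow> [p = t + q] (mod m)"
      by (simp add: cyclic_group_mat_def U_mat_pow_eq_iff[OF m] flip: U_mat_pow_add)
    also have "\<dots> \<longleftrightarrow> [int p - int q = int t] (mod int m)"
      unfolding cong_int_iff[symmetric] cong_iff_dvd_diff by (simp add: algebra_simps)
    finally show ?thesis .
  qed
  have "bgw_weights n m e W"
  proof
    fix i j assume ij: "i \<le> n" "j \<le> n"
    have "W $$ (i, j) = W $$ (j, i)"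
      using arg_cong[OF sym, of "\<lambda>X. X $$ (i, j)"] W ij by simp
    then show "e i j = e j i" by (simp add: e_def)
  next
    fix i h and t :: int assume ih: "i \<le> n" "h \<le> n" "i \<noteq> h"
    define r where "r = nat (t mod int m)"
    have r: "[int r = t] (mod int m)" using m by (simp add: r_def cong_def)
    have "{j. j < n + 1 \<and> (\<exists>a b. W $$ (i, j) = Some a \<and> W $$ (h, j) = Some b \<and>
        a \<otimes>\<^bsub>?G\<^esub> inv\<^bsub>?G\<^esub> b = U_mat m ^\<^sub>m r)}
      = {j. j \<le> n \<and> j \<noteq> i \<and> j \<noteq> h \<and> [e i j - e h j = t] (mod int m)}" (is "?L = ?R")
    proof (rule Set.set_eqI)
      fix j
      show "j \<in> ?L \<longleftrightarrow> j \<in> ?R"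
      proof (cases "j \<le> n \<and> j \<noteq> i \<and> j \<noteq> h")
        case True
        obtain p where p: "e i j = int p" "W $$ (i, j) = Some (U_mat m ^\<^sub>m p)" using entry[of i j] ih True by blast
        obtain q where q: "e h j = int q" "W $$ (h, j) = Some (U_mat m ^\<^sub>m q)" using entry[of h j] ih True by blast
        have "[int p - int q = int r] (mod int m) \<longleftrightarrow> [int p - int q = t] (mod int m)"
          using r by (meson cong_sym cong_trans)
        then show ?thesis using True by (simp add: p q quotient)
      next
        case False
        then show ?thesis using diag ih by auto
      qed
    qed
    then have "real (card ?R) = real (n - 1) / real m"
      using bal[OF ih U_in, of r] group_cyclic_group_mat(2)[OF m] by simp
    then have "real (m * card ?R) = real (n - 1)" using m by (simp add: field_simps)
    then show "m * card ?R = n - 1" by (simp only: of_nat_eq_iff)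
  qed (use n m entry in auto)
  then show thesis by (rule that)
qed

theorem corollary4p9:
  fixes n m :: nat and W :: "complex mat option mat"
  assumes "n > 0" and "m > 0"
    and "BGW (cyclic_group_mat m) (n + 1) n (n - 1) W"
    and "transpose_mat W = W"
    and "\<forall>i < n + 1. W $$ (i, i) = None"
  shows "(even m \<longrightarrow>
            symmetric_association_scheme ((n + 1) * m) (scheme_even n m W) \<and>
            second_eigenmatrix ((n + 1) * m) (scheme_even n m W) (Q_even n m)) \<and>
         (odd m \<longrightarrow>
            symmetric_association_scheme ((n + 1) * m) (scheme_odd n m W) \<and>
            second_eigenmatrix ((n + 1) * m) (scheme_odd n m W) (Q_odd n m))"
proof -
  obtain e where "bgw_weights n m e W"
    using bgw_weights_of_BGW[OF assms] .
  then interpret bgw_weights n m e W .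
  have "distinct (h # [1..<h])" "set (h # [1..<h]) = {1..h}" if "even m"
    using that m_pos by (auto elim!: evenE)
  moreover have "distinct [1..<h + 1]" "set [1..<h + 1] = {1..h}"
    by auto
  ultimately show ?thesis
    using symmetric_scheme second_eigenmatrix_qcol scheme_even_eq scheme_odd_eq Q_even_eq Q_odd_eq
    by metis
qed

end
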